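(* Let $I$ be a square-free monomial ideal, in a polynomial ring over a field $\mathsf{k}$, minimally generated by $q$ elements. Then: - if $q=3$, then $\rho(I)=\rho_a(I)\le\rho(\mathcal{E}_3)=\rho_a(\mathcal{E}_3)=4/3$; - if $q=4$, then $\rho_a(I)\le\rho_a(\mathcal{E}_4)=3/2$; - if $q=5$, then $\rho_a(I)\le\rho_a(\mathcal{E}_5)=8/5$.
   Context: Let $[q]=\{1,\dots,q\}$ and $S_{[q]}=\mathsf{k}[y_A : \emptyset\neq A\subseteq[q]]$. For $i\in[q]$ set $\epsilon_i=\prod_{A\subseteq[q],\, i\in A}y_A$. The $q$-extremal ideal is $\mathcal{E}_q=(\epsilon_1,\dots,\epsilon_q)\subseteq S_{[q]}$. For a square-free monomial ideal $J$, the $s$-th symbolic power is $J^{(s)}=\bigcap_{P\in\mathrm{Min}(J)}P^s$, where $\mathrm{Min}(J)$ is the set of minimal primes of $J$. The resurgence is $\rho(J)=\sup\{\frac sr : s,r \text{ positive integers},\ J^{(s)}\not\subseteq J^r\}$ and the asymptotic resurgence is $\rho_a(J)=\sup\{\frac sr : s,r\text{ positive integers},\ J^{(st)}\not\subseteq J^{rt}\text{ for all } t\gg0\}$ (by a known result, $\rho_a(J)=\sup\{\frac sr: J^{(s)}\not\subseteq\overline{J^r}\}$, where $\overline{\phantom{J}}$ denotes integral closure). *)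

theory Defs
  imports
    "HOL-Algebra.Ideal_Product"
    "HOL-Library.Poly_Mapping"
    "HOL-Library.Extended_Real"
begin

text \<open>
  The polynomial ring \<open>k[V]\<close> on a set \<open>V\<close> of variables is realised on the finitely supported maps
  from exponent vectors to coefficients (with the convolution product of
  \<^theory>\<open>HOL-Library.Poly_Mapping\<close>). The variables are a set rather than a type, so that
  \<open>S_[q]\<close> can be treated for a natural number \<open>q\<close>.
\<close>

definition poly_ring :: "'v set \<Rightarrow> (('v \<Rightarrow>\<^sub>0 nat) \<Rightarrow>\<^sub>0 'k::field) ring" where
  "poly_ring V = \<lparr>carrier = {p. \<forall>m \<in> Poly_Mapping.keys p. Poly_Mapping.keys m \<subseteq> V},
     mult = (*), one = 1, zero = 0, add = (+)\<rparr>"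

definition pvar :: "'v \<Rightarrow> (('v \<Rightarrow>\<^sub>0 nat) \<Rightarrow>\<^sub>0 'k::field)" where
  "pvar v = Poly_Mapping.single (Poly_Mapping.single v 1) 1"

lemma poly_ring_cring: "cring (poly_ring V :: (('v \<Rightarrow>\<^sub>0 nat) \<Rightarrow>\<^sub>0 'k::field) ring)"
proof (rule cringI)
  let ?R = "poly_ring V :: (('v \<Rightarrow>\<^sub>0 nat) \<Rightarrow>\<^sub>0 'k) ring"
  have add: "p + q \<in> carrier ?R" if "p \<in> carrier ?R" "q \<in> carrier ?R" for p q
    using that Poly_Mapping.keys_add[of p q] by (auto simp: poly_ring_def)
  have neg: "- p \<in> carrier ?R" if "p \<in> carrier ?R" for p
    using that by (auto simp: poly_ring_def in_keys_iff lookup_uminus)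
  have mult: "p * q \<in> carrier ?R" if "p \<in> carrier ?R" "q \<in> carrier ?R" for p q
  proof -
    have "Poly_Mapping.keys m \<subseteq> V" if m: "m \<in> Poly_Mapping.keys (p * q)" for m
    proof -
      obtain a b where ab: "m = a + b" "a \<in> Poly_Mapping.keys p" "b \<in> Poly_Mapping.keys q"
        using m keys_mult[of p q] by blast
      show ?thesis
        using ab Poly_Mapping.keys_add[of a b] \<open>p \<in> carrier ?R\<close> \<open>q \<in> carrier ?R\<close>
        by (auto simp: poly_ring_def)
    qed
    then show ?thesis by (simp add: poly_ring_def)
  qed
  have zero_one: "0 \<in> carrier ?R" "1 \<in> carrier ?R"
    by (simp_all add: poly_ring_def)
  have ops: "mult ?R = (*)" "one ?R = 1" "zero ?R = 0" "add ?R = (+)"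
    by (simp_all add: poly_ring_def)
  show "abelian_group ?R"
  proof (rule abelian_groupI, unfold ops)
    fix x assume "x \<in> carrier ?R"
    then show "\<exists>y \<in> carrier ?R. y + x = 0"
      using neg by (intro bexI[of _ "- x"]) simp_all
  qed (fact add zero_one | simp add: add.assoc | simp add: add.commute)+
  show "Group.comm_monoid ?R"
    by (rule comm_monoidI, unfold ops)
      (fact mult zero_one | simp add: mult.assoc | simp add: mult.commute)+
  fix x y z assume "x \<in> carrier ?R" "y \<in> carrier ?R" "z \<in> carrier ?R"
  show "(x \<oplus>\<^bsub>?R\<^esub> y) \<otimes>\<^bsub>?R\<^esub> z = x \<otimes>\<^bsub>?R\<^esub> z \<oplus>\<^bsub>?R\<^esub> y \<otimes>\<^bsub>?R\<^esub> z"
    unfolding ops by (rule distrib_right)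
qed

definition squarefree_monomials :: "'v set \<Rightarrow> (('v \<Rightarrow>\<^sub>0 nat) \<Rightarrow>\<^sub>0 'k::field) set" where
  "squarefree_monomials V = {\<Prod>v\<in>A. pvar v | A. finite A \<and> A \<subseteq> V}"

text \<open>
  \<open>I\<close> is a square-free monomial ideal of \<open>k[V]\<close> whose minimal monomial generating set has exactly
  \<open>q\<close> elements. (The generators are required to be monomials: an irredundant generating set of
  arbitrary polynomials does not have a well-defined cardinality.)
\<close>

definition squarefree_monomial_ideal_with_min_gens ::
    "'v set \<Rightarrow> (('v \<Rightarrow>\<^sub>0 nat) \<Rightarrow>\<^sub>0 'k::field) set \<Rightarrow> nat \<Rightarrow> bool" where
  "squarefree_monomial_ideal_with_min_gens V I q \<longleftrightarrow>
     (\<exists>G. G \<subseteq> squarefree_monomials V \<and> finite G \<and> card G = q \<and>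
          I = Idl\<^bsub>poly_ring V\<^esub> G \<and> (\<forall>H. H \<subset> G \<longrightarrow> Idl\<^bsub>poly_ring V\<^esub> H \<noteq> I))"

definition minimal_primes :: "('a, 'b) ring_scheme \<Rightarrow> 'a set \<Rightarrow> 'a set set" where
  "minimal_primes R J = {P. primeideal P R \<and> J \<subseteq> P \<and>
     (\<forall>Q. primeideal Q R \<and> J \<subseteq> Q \<and> Q \<subseteq> P \<longrightarrow> Q = P)}"

abbreviation ideal_power :: "('a, 'b) ring_scheme \<Rightarrow> 'a set \<Rightarrow> nat \<Rightarrow> 'a set" where
  "ideal_power R J n \<equiv> J [^]\<^bsub>ideals_set R\<^esub> n"

text \<open>The intersection is taken inside \<open>R\<close>. This is the description of symbolic powers that is
  valid for radical ideals, such as square-free monomial ideals.\<close>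

definition symbolic_power :: "('a, 'b) ring_scheme \<Rightarrow> 'a set \<Rightarrow> nat \<Rightarrow> 'a set" where
  "symbolic_power R J s = carrier R \<inter> (\<Inter>P \<in> minimal_primes R J. ideal_power R P s)"

text \<open>The suprema are taken in the extended reals, so that no boundedness is presupposed.\<close>

definition resurgence :: "('a, 'b) ring_scheme \<Rightarrow> 'a set \<Rightarrow> ereal" where
  "resurgence R J = Sup {ereal (real s / real r) | s r.
     s > 0 \<and> r > 0 \<and> \<not> symbolic_power R J s \<subseteq> ideal_power R J r}"

definition asymptotic_resurgence :: "('a, 'b) ring_scheme \<Rightarrow> 'a set \<Rightarrow> ereal" where
  "asymptotic_resurgence R J = Sup {ereal (real s / real r) | s r.
     s > 0 \<and> r > 0 \<and>
     (\<forall>\<^sub>F t in sequentially. \<not> symbolic_power R J (s * t) \<subseteq> ideal_power R J (r * t))}"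

definition extremal_vars :: "nat \<Rightarrow> nat set set" where
  "extremal_vars q = {A. A \<noteq> {} \<and> A \<subseteq> {1..q}}"

definition extremal_ring :: "nat \<Rightarrow> ((nat set \<Rightarrow>\<^sub>0 nat) \<Rightarrow>\<^sub>0 'k::field) ring" where
  "extremal_ring q = poly_ring (extremal_vars q)"

definition extremal_gen :: "nat \<Rightarrow> nat \<Rightarrow> ((nat set \<Rightarrow>\<^sub>0 nat) \<Rightarrow>\<^sub>0 'k::field)" where
  "extremal_gen q i = (\<Prod>A \<in> {A \<in> extremal_vars q. i \<in> A}. pvar A)"

definition extremal_ideal :: "nat \<Rightarrow> ((nat set \<Rightarrow>\<^sub>0 nat) \<Rightarrow>\<^sub>0 'k::field) set" where
  "extremal_ideal q = Idl\<^bsub>extremal_ring q\<^esub> (extremal_gen q ` {1..q})"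

end

theory Submission
  imports Defs
begin

text \<open>
  Let \<open>I\<close> be generated by square-free monomials \<open>g\<^sub>1, \<dots>, g\<^sub>q\<close>, and let \<open>T v = {i. v divides g\<^sub>i}\<close> for every
  variable \<open>v\<close>. Membership in powers and symbolic powers is decided on exponent vectors \<open>m\<close>:

    \<^item> \<open>m\<close> lies in \<open>I\<^sup>r\<close> iff there are natural numbers \<open>n\<^sub>1, \<dots>, n\<^sub>q\<close> with sum at least \<open>r\<close> and
      \<open>(\<Sum>i\<in>T v. n\<^sub>i) \<le> m v\<close> for all \<open>v\<close>, an integral packing (\<open>ideal_power_eq\<close>);
    \<^item> \<open>m\<close> lies in the \<open>s\<close>-th symbolic power iff every set \<open>C\<close> of variables with \<open>(\<Union>v\<in>C. T v) = {1..q}\<close>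
      has \<open>s \<le> (\<Sum>v\<in>C. m v)\<close> (\<open>symbolic_power_eq\<close>), because the minimal primes are generated by the
      variables in the minimal such \<open>C\<close>.

  So \<open>m\<close> is a cost function in a weighted set cover problem with ground set \<open>{1..q}\<close>: the symbolic power
  speaks of the cheapest integral cover, and by linear programming duality the largest real packing has
  the size of the cheapest fractional cover. Rounding a real packing down loses at most \<open>q\<close>, which is
  negligible asymptotically. Hence the asymptotic resurgence of \<open>I\<close> is at most the integrality gap of
  set cover with \<open>q\<close> elements (\<open>asymptotic_resurgence_le\<close>).

  The heart of the matter is that for \<open>q = 3, 4, 5\<close> this gap is at most \<open>2 (q - 1) / q\<close>
  (\<open>cover_gap_3\<close>, \<open>cover_gap_4\<close>, \<open>cover_gap_5\<close>). The proof is by induction on \<open>q\<close>: a fractional cover \<open>w\<close> may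
  be taken with support of size at most \<open>q\<close>; every single set \<open>T v\<close> is completed to an integral cover by
  a cheap cover of the at most \<open>q - 1\<close> remaining elements, and a suitable weighted average of these
  covers is cheap (\<open>cover_gap_step\<close>). The bound is attained by the extremal ideal: if each proper
  nonempty subset of \<open>{1..q}\<close> costs \<open>k\<close> and the full set \<open>2 k\<close>, integral covers cost at least \<open>2 k\<close>, while the
  sets of size \<open>q - 1\<close> with weight \<open>1 / (q - 1)\<close> form a fractional cover of cost \<open>k q / (q - 1)\<close>
  (\<open>asymptotic_resurgence_extremal_ge\<close>).

  For three generators, every real packing with integral capacities can be rounded to an integral one
  of the same integral size (\<open>integral_packing_of_three\<close>). So an exponent vector that witnesses
  non-containment for \<open>(s, r)\<close> has multiples that witness it for all \<open>(s t, r t)\<close>, and the resurgence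
  equals the asymptotic resurgence (\<open>resurgence_eq_if_three_generators\<close>).
\<close>

section \<open>Fractional covers with small support\<close>

text \<open>
  Gaussian elimination: if some coefficient of the equation \<open>i\<close> is nonzero, the corresponding unknown is
  eliminated from the other equations.
\<close>

lemma linear_dependence:
  fixes a :: "'s \<Rightarrow> 'i \<Rightarrow> real"
  assumes "finite N" "finite S" "card N < card S"
  shows "\<exists>u. (\<exists>s\<in>S. u s \<noteq> 0) \<and> (\<forall>i\<in>N. (\<Sum>s\<in>S. u s * a s i) = 0)"
  using assms
proof (induction N arbitrary: S a rule: finite_induct)
  case empty
  then have "S \<noteq> {}" by auto
  then show ?case by (intro exI[of _ "\<lambda>_. 1"]) auto
next
  case (insert i N)
  show ?case
  proof (cases "\<forall>s\<in>S. a s i = 0")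
    case True
    have "card N < card S" using insert by simp
    from insert.IH[OF insert.prems(1) this, of a] obtain u where
      "\<exists>s\<in>S. u s \<noteq> 0" "\<forall>j\<in>N. (\<Sum>s\<in>S. u s * a s j) = 0" by blast
    moreover have "(\<Sum>s\<in>S. u s * a s i) = 0" using True by simp
    ultimately show ?thesis by blast
  next
    case False
    then obtain t where t: "t \<in> S" "a t i \<noteq> 0" by auto
    define S' where "S' = S - {t}"
    have S: "S = insert t S'" "t \<notin> S'" "finite S'" using t insert.prems by (auto simp: S'_def)
    have "card N < card S'" using insert S by simp
    from insert.IH[OF S(3) this, of "\<lambda>s j. a s j - a s i / a t i * a t j"] obtain u where
      u: "\<exists>s\<in>S'. u s \<noteq> 0" "\<forall>j\<in>N. (\<Sum>s\<in>S'. u s * (a s j - a s i / a t i * a t j)) = 0" by blast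
    define ut where "ut = - (\<Sum>s\<in>S'. u s * a s i) / a t i"
    let ?u = "u(t := ut)"
    have sum: "(\<Sum>s\<in>S. ?u s * a s j) = ut * a t j + (\<Sum>s\<in>S'. u s * a s j)" for j
    proof -
      have "(\<Sum>s\<in>S'. ?u s * a s j) = (\<Sum>s\<in>S'. u s * a s j)"
        using S(2) by (intro sum.cong) auto
      then show ?thesis using S by simp
    qed
    have "(\<Sum>s\<in>S. ?u s * a s j) = 0" if "j \<in> insert i N" for j
    proof (cases "j = i")
      case True
      then show ?thesis unfolding sum using t by (simp add: ut_def)
    next
      case False
      then have "(\<Sum>s\<in>S'. u s * (a s j - a s i / a t i * a t j)) = 0" using u that by auto
      moreover have "(\<Sum>s\<in>S'. u s * (a s j - a s i / a t i * a t j)) = (\<Sum>s\<in>S'. u s * a s j) - (\<Sum>s\<in>S'. u s * a s i) / a t i * a t j"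
        by (simp add: algebra_simps sum_subtractf sum_distrib_left sum_divide_distrib)
      ultimately show ?thesis unfolding sum by (simp add: ut_def)
    qed
    moreover have "\<exists>s\<in>S. ?u s \<noteq> 0" using u(1) S by auto
    ultimately show ?thesis by blast
  qed
qed

lemma finite_minimizer:
  fixes f :: "'a \<Rightarrow> real"
  assumes "finite M" "M \<noteq> {}"
  obtains v where "v \<in> M" "\<And>u. u \<in> M \<Longrightarrow> f v \<le> f u"
  using arg_min_if_finite(1)[OF assms, of f] arg_min_least[OF assms, of _ f] by blast

definition fractional_cover :: "'i set \<Rightarrow> 'v set \<Rightarrow> ('v \<Rightarrow> 'i set) \<Rightarrow> ('v \<Rightarrow> real) \<Rightarrow> bool" where
  "fractional_cover X V T w \<longleftrightarrow> (\<forall>v\<in>V. 0 \<le> w v) \<and> (\<forall>i\<in>X. 1 \<le> (\<Sum>v\<in>{v\<in>V. i \<in> T v}. w v))"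

lemma fractional_coverD:
  assumes "fractional_cover X V T w"
  shows "v \<in> V \<Longrightarrow> 0 \<le> w v" "i \<in> X \<Longrightarrow> 1 \<le> (\<Sum>v\<in>{v\<in>V. i \<in> T v}. w v)"
  using assms by (auto simp: fractional_cover_def)

lemma fractional_cover_subset:
  assumes "fractional_cover X V T w" "finite V" "V' \<subseteq> V" "Y \<subseteq> X"
    and "\<And>v. v \<in> V - V' \<Longrightarrow> w v = 0 \<or> T v \<inter> Y = {}"
  shows "fractional_cover Y V' T w"
  unfolding fractional_cover_def
proof (intro conjI ballI)
  fix v assume "v \<in> V'" then show "0 \<le> w v" using assms by (auto simp: fractional_cover_def)
next
  fix i assume i: "i \<in> Y"
  have "(\<Sum>v\<in>{v\<in>V'. i \<in> T v}. w v) = (\<Sum>v\<in>{v\<in>V. i \<in> T v}. w v)"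
    using assms i by (intro sum.mono_neutral_left) auto
  then show "1 \<le> (\<Sum>v\<in>{v\<in>V'. i \<in> T v}. w v)" using assms i by (auto simp: fractional_cover_def)
qed

text \<open>
  The weights that put the same total as \<open>w\<close> on each element form a polyhedron given by \<open>card X\<close> equations
  and nonnegativity, so its vertices have at most \<open>card X\<close> nonzero coordinates. Concretely, a linear
  dependence \<open>u\<close> between the incidence vectors of the support, oriented so that moving along \<open>u\<close> does not
  increase the cost, allows weight to be shifted until a coordinate vanishes.
\<close>

lemma sparse_fractional_cover:
  fixes T :: "'v \<Rightarrow> 'i set" and c :: "'v \<Rightarrow> real"
  assumes "finite X" "finite V" "\<And>v. v \<in> V \<Longrightarrow> T v \<inter> X \<noteq> {}"
    and "fractional_cover X V T w"
  shows "\<exists>w'. fractional_cover X V T w' \<and> (\<Sum>v\<in>V. w' v * c v) \<le> (\<Sum>v\<in>V. w v * c v)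
              \<and> card {v\<in>V. w' v \<noteq> 0} \<le> card X"
  using assms(4)
proof (induction "card {v\<in>V. w v \<noteq> 0}" arbitrary: w rule: less_induct)
  case less
  define S where "S = {v\<in>V. w v \<noteq> 0}"
  have finS: "finite S" "S \<subseteq> V" using assms by (auto simp: S_def)
  show ?case
  proof (cases "card S \<le> card X")
    case True
    then show ?thesis using less.prems unfolding S_def by blast
  next
    case False
    then have "card X < card S" by simp
    from linear_dependence[OF assms(1) finS(1) this, of "\<lambda>v i. of_bool (i \<in> T v)"]
    obtain u0 :: "'v \<Rightarrow> real" where u0: "\<exists>v\<in>S. u0 v \<noteq> 0" "\<forall>i\<in>X. (\<Sum>v\<in>S. u0 v * of_bool (i \<in> T v)) = 0" by blast
    define u where "u = (if (\<Sum>v\<in>S. u0 v * c v) \<le> 0 then u0 else (\<lambda>v. - u0 v))"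
    have u: "\<exists>v\<in>S. u v \<noteq> 0" "\<forall>i\<in>X. (\<Sum>v\<in>S. u v * of_bool (i \<in> T v)) = 0" "(\<Sum>v\<in>S. u v * c v) \<le> 0"
      using u0 by (auto simp: u_def sum_negf)
    have w_pos: "w v > 0" if "v \<in> S" for v
      using that less.prems by (force simp: S_def fractional_cover_def)
    define M where "M = {v\<in>S. u v < 0}"
    \<comment> \<open>Some coordinate decreases along \<open>u\<close>: otherwise \<open>u\<close> would vanish on every set that meets \<open>X\<close>.\<close>
    have "M \<noteq> {}"
    proof
      assume "M = {}"
      then have nonneg: "\<forall>v\<in>S. 0 \<le> u v" by (force simp: M_def)
      obtain v where v: "v \<in> S" "u v \<noteq> 0" using u(1) by blast
      then obtain i where i: "i \<in> T v" "i \<in> X" using assms(3) finS by blast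
      have "(\<Sum>v\<in>S. u v * of_bool (i \<in> T v)) = 0" using u(2) i by blast
      then have "\<forall>v\<in>S. u v * of_bool (i \<in> T v) = 0"
        using nonneg finS by (subst (asm) sum_nonneg_eq_0_iff) auto
      then show False using v i by auto
    qed
    moreover have "finite M" using finS by (auto simp: M_def)
    ultimately obtain v0 where v0: "v0 \<in> M" "\<And>v. v \<in> M \<Longrightarrow> w v0 / - u v0 \<le> w v / - u v"
      using finite_minimizer[of M "\<lambda>v. w v / - u v"] by blast
    \<comment> \<open>The longest step along \<open>u\<close> that keeps all weights nonnegative; it makes the weight of \<open>v0\<close> zero.\<close>
    define \<theta> where "\<theta> = w v0 / - u v0"
    have \<theta>: "\<theta> > 0" using v0(1) w_pos by (auto simp: \<theta>_def M_def field_simps)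
    define w' where "w' v = (if v \<in> S then w v + \<theta> * u v else 0)" for v
    have w0: "w v = 0" if "v \<in> V - S" for v using that by (auto simp: S_def)
    have eq: "(\<Sum>v\<in>V. w' v * f v) = (\<Sum>v\<in>V. w v * f v) + \<theta> * (\<Sum>v\<in>S. u v * f v)" for f
    proof -
      have "(\<Sum>v\<in>V. w' v * f v) = (\<Sum>v\<in>S. w' v * f v)"
        using assms finS by (intro sum.mono_neutral_right) (auto simp: w'_def)
      also have "\<dots> = (\<Sum>v\<in>S. w v * f v) + \<theta> * (\<Sum>v\<in>S. u v * f v)"
        by (simp add: w'_def algebra_simps sum.distrib sum_distrib_left)
      also have "(\<Sum>v\<in>S. w v * f v) = (\<Sum>v\<in>V. w v * f v)"
        using assms finS w0 by (intro sum.mono_neutral_left) auto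
      finally show ?thesis .
    qed
    have eq': "(\<Sum>v\<in>{v\<in>V. i \<in> T v}. g v) = (\<Sum>v\<in>V. g v * of_bool (i \<in> T v))" for i and g :: "'v \<Rightarrow> real"
      unfolding sum.inter_filter[OF assms(2)] by (intro sum.cong) auto
    have nonneg: "0 \<le> w' v" for v
    proof (cases "v \<in> M")
      case True
      then have "\<theta> \<le> w v / - u v" "u v < 0" using v0 by (auto simp: \<theta>_def M_def)
      then show ?thesis by (auto simp: w'_def field_simps)
    next
      case False
      then show ?thesis using \<theta> w_pos[of v] by (auto simp: w'_def M_def not_less)
    qed
    have "fractional_cover X V T w'"
      unfolding fractional_cover_def
    proof (intro conjI ballI)
      fix i assume i: "i \<in> X"
      show "1 \<le> (\<Sum>v\<in>{v\<in>V. i \<in> T v}. w' v)"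
        unfolding eq' eq using u(2) i fractional_coverD(2)[OF less.prems i] by (simp add: eq')
    qed (rule nonneg)
    moreover have "(\<Sum>v\<in>V. w' v * c v) \<le> (\<Sum>v\<in>V. w v * c v)"
      using u(3) \<theta> by (simp add: eq mult_nonneg_nonpos)
    moreover have "card {v\<in>V. w' v \<noteq> 0} < card {v\<in>V. w v \<noteq> 0}"
    proof (rule psubset_card_mono)
      have "w' v0 = 0" using v0(1) by (simp add: w'_def \<theta>_def M_def)
      moreover have "v0 \<in> S" using v0 by (auto simp: M_def)
      ultimately show "{v\<in>V. w' v \<noteq> 0} \<subset> {v\<in>V. w v \<noteq> 0}"
        unfolding S_def[symmetric] using finS by (auto simp: w'_def split: if_splits)
    qed (use assms in auto)
    ultimately show ?thesis using less.hyps[of w'] by force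
  qed
qed

section \<open>The integrality gap of set cover with at most five elements\<close>

text \<open>
  This bounds the integrality gap of the linear relaxation of weighted set cover. The type arguments
  record the types of elements and of set names, which do not occur in the type of the proposition;
  distinct names may stand for the same set.
\<close>

definition cover_gap :: "'i itself \<Rightarrow> 'v itself \<Rightarrow> nat \<Rightarrow> real \<Rightarrow> bool" where
  "cover_gap _ _ k \<rho> \<longleftrightarrow> (\<forall>(X :: 'i set) (V :: 'v set) T c w. finite X \<and> card X = k \<and> finite V \<and>
     (\<forall>v\<in>V. 0 \<le> c v) \<and> fractional_cover X V T w \<longrightarrow>
     (\<exists>D\<subseteq>V. X \<subseteq> (\<Union>v\<in>D. T v) \<and> sum c D \<le> \<rho> * (\<Sum>v\<in>V. w v * c v)))"

lemma cover_gapD: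
  fixes k :: nat and \<rho> :: real and X :: "'i set" and V :: "'v set" and c :: "'v \<Rightarrow> real"
  assumes "cover_gap TYPE('i) TYPE('v) k \<rho>" "finite X" "card X = k" "finite V"
    "\<And>v. v \<in> V \<Longrightarrow> 0 \<le> c v" "fractional_cover X V T w"
  obtains D where "D \<subseteq> V" "X \<subseteq> (\<Union>v\<in>D. T v)" "sum c D \<le> \<rho> * (\<Sum>v\<in>V. w v * c v)"
  using assms unfolding cover_gap_def by blast

lemma cheapest_set:
  fixes c w :: "'v \<Rightarrow> real"
  assumes "finite U" "\<And>v. v \<in> U \<Longrightarrow> 0 \<le> w v" "0 < (\<Sum>v\<in>U. w v)"
  shows "\<exists>v\<in>U. c v * (\<Sum>v\<in>U. w v) \<le> (\<Sum>v\<in>U. w v * c v)"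
proof -
  have "U \<noteq> {}" using assms by auto
  then obtain v where v: "v \<in> U" "\<And>u. u \<in> U \<Longrightarrow> c v \<le> c u"
    using finite_minimizer[OF assms(1), of c] by blast
  have "c v * (\<Sum>v\<in>U. w v) = (\<Sum>u\<in>U. w u * c v)" by (simp add: sum_distrib_left mult.commute)
  also have "\<dots> \<le> (\<Sum>u\<in>U. w u * c u)" using v assms by (intro sum_mono mult_left_mono) auto
  finally show ?thesis using v by blast
qed

text \<open>
  Let the sets that contain all of \<open>X\<close> have total weight \<open>\<omega>\<close>. If each of them costs more than the whole
  fractional cover, then \<open>\<omega> < 1\<close> and they contribute at least the proportion \<open>\<omega>\<close> of the cost. So
  dropping them and scaling the other weights by \<open>1 / (1 - \<omega>)\<close> gives a fractional cover that is not
  more expensive and uses no full set.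
\<close>

lemma cover_gap_if_no_full_set:
  assumes "1 \<le> \<rho>" "k > 0"
    and *: "\<And>(X :: 'i set) (V :: 'v set) T c w. finite X \<Longrightarrow> card X = k \<Longrightarrow> finite V \<Longrightarrow>
      (\<And>v. v \<in> V \<Longrightarrow> 0 \<le> c v) \<Longrightarrow> (\<And>v. v \<in> V \<Longrightarrow> \<not> X \<subseteq> T v) \<Longrightarrow>
      fractional_cover X V T w \<Longrightarrow>
      \<exists>D\<subseteq>V. X \<subseteq> (\<Union>v\<in>D. T v) \<and> sum c D \<le> \<rho> * (\<Sum>v\<in>V. w v * c v)"
  shows "cover_gap TYPE('i) TYPE('v) k \<rho>"
  unfolding cover_gap_def
proof (intro allI impI, elim conjE)
  fix X :: "'i set" and V :: "'v set" and T and c w :: "'v \<Rightarrow> real"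
  assume X: "finite X" "card X = k" and V: "finite V" and c: "\<forall>v\<in>V. 0 \<le> c v"
    and w: "fractional_cover X V T w"
  define U where "U = {v\<in>V. X \<subseteq> T v}"
  define W where "W = {v\<in>V. \<not> X \<subseteq> T v}"
  define F where "F = (\<Sum>v\<in>V. w v * c v)"
  define \<omega> where "\<omega> = (\<Sum>v\<in>U. w v)"
  have UW: "V = U \<union> W" "U \<inter> W = {}" "finite U" "finite W" using V by (auto simp: U_def W_def)
  have F: "F = (\<Sum>v\<in>U. w v * c v) + (\<Sum>v\<in>W. w v * c v)"
    unfolding F_def UW(1) by (rule sum.union_disjoint) (use UW in auto)
  have w0: "0 \<le> w v" if "v \<in> V" for v using that w by (auto simp: fractional_cover_def)
  have FW: "0 \<le> (\<Sum>v\<in>W. w v * c v)" "0 \<le> (\<Sum>v\<in>U. w v * c v)" using w0 c UW by (auto intro!: sum_nonneg)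
  show "\<exists>D\<subseteq>V. X \<subseteq> (\<Union>v\<in>D. T v) \<and> sum c D \<le> \<rho> * (\<Sum>v\<in>V. w v * c v)"
  proof (cases "\<exists>v\<in>U. c v \<le> F")
    case True
    then obtain v where v: "v \<in> U" "c v \<le> F" by blast
    have "F \<le> \<rho> * F" using FW F assms(1) mult_right_mono[of 1 \<rho> F] by simp
    then show ?thesis using v by (intro exI[of _ "{v}"]) (auto simp: U_def F_def)
  next
    case False
    have le: "\<omega> * F \<le> (\<Sum>v\<in>U. w v * c v)"
      unfolding \<omega>_def sum_distrib_right using False w0 UW by (intro sum_mono mult_left_mono) auto
    have lt1: "\<omega> < 1"
    proof (rule ccontr)
      assume "\<not> \<omega> < 1"
      then have "1 \<le> \<omega>" by simp
      then obtain v where v: "v \<in> U" "c v * \<omega> \<le> (\<Sum>v\<in>U. w v * c v)"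
        using cheapest_set[OF UW(3), of w c] w0 UW unfolding \<omega>_def by force
      have "0 \<le> c v" using v c UW by auto
      then have "c v * 1 \<le> c v * \<omega>" using \<open>1 \<le> \<omega>\<close> by (intro mult_left_mono) auto
      then have "c v \<le> F" using v F FW by simp
      then show False using False v by blast
    qed
    have fW: "fractional_cover X W T (\<lambda>v. w v / (1 - \<omega>))"
      unfolding fractional_cover_def
    proof (intro conjI ballI)
      fix v assume "v \<in> W" then show "0 \<le> w v / (1 - \<omega>)" using w0 UW lt1 by auto
    next
      fix i assume i: "i \<in> X"
      have "{v\<in>V. i \<in> T v} = U \<union> {v\<in>W. i \<in> T v}" using i by (auto simp: U_def W_def)
      then have "(\<Sum>v\<in>{v\<in>V. i \<in> T v}. w v) = \<omega> + (\<Sum>v\<in>{v\<in>W. i \<in> T v}. w v)"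
        unfolding \<omega>_def using UW by (simp, intro sum.union_disjoint) auto
      then have "1 - \<omega> \<le> (\<Sum>v\<in>{v\<in>W. i \<in> T v}. w v)"
        using w i by (auto simp: fractional_cover_def)
      then show "1 \<le> (\<Sum>v\<in>{v\<in>W. i \<in> T v}. w v / (1 - \<omega>))"
        using lt1 by (simp add: sum_divide_distrib[symmetric])
    qed
    have cW: "0 \<le> c v" "\<not> X \<subseteq> T v" if "v \<in> W" for v using that c by (auto simp: W_def)
    have "\<exists>D\<subseteq>W. X \<subseteq> (\<Union>v\<in>D. T v) \<and> sum c D \<le> \<rho> * (\<Sum>v\<in>W. w v / (1 - \<omega>) * c v)"
      by (rule *[OF X UW(4) cW fW])
    then obtain D where D: "D \<subseteq> W" "X \<subseteq> (\<Union>v\<in>D. T v)"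
        "sum c D \<le> \<rho> * (\<Sum>v\<in>W. w v / (1 - \<omega>) * c v)"
      by blast
    have "(\<Sum>v\<in>W. w v / (1 - \<omega>) * c v) = (\<Sum>v\<in>W. w v * c v) / (1 - \<omega>)"
      by (simp add: sum_divide_distrib)
    also have "\<dots> \<le> F" using F le lt1 by (simp add: field_simps)
    finally have "sum c D \<le> \<rho> * F" using D(3) assms(1)
      by (smt (verit) mult_left_mono)
    then show ?thesis using D UW by (intro exI[of _ D]) (auto simp: F_def)
  qed
qed

lemma cover_gap_1: "cover_gap TYPE('i) TYPE('v) 1 1"
proof (rule cover_gap_if_no_full_set, simp, simp)
  fix X :: "'i set" and V :: "'v set" and T and c w :: "'v \<Rightarrow> real"
  assume X: "card X = 1" and full: "\<And>v. v \<in> V \<Longrightarrow> \<not> X \<subseteq> T v" and w: "fractional_cover X V T w"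
  obtain i where i: "X = {i}" using X by (auto simp: card_1_singleton_iff)
  have "{v\<in>V. i \<in> T v} = {}" using full i by auto
  then have "1 \<le> (\<Sum>v\<in>{}. w v)" using w i by (metis fractional_coverD(2) singletonI)
  then show "\<exists>D\<subseteq>V. X \<subseteq> (\<Union>v\<in>D. T v) \<and> sum c D \<le> 1 * (\<Sum>v\<in>V. w v * c v)" by simp
qed

lemma cover_gap_2: "cover_gap TYPE('i) TYPE('v) 2 1"
proof (rule cover_gap_if_no_full_set, simp, simp)
  fix X :: "'i set" and V :: "'v set" and T and c w :: "'v \<Rightarrow> real"
  assume X: "card X = 2" and V: "finite V" and c: "\<And>v. v \<in> V \<Longrightarrow> 0 \<le> c v"
    and full: "\<And>v. v \<in> V \<Longrightarrow> \<not> X \<subseteq> T v" and w: "fractional_cover X V T w"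
  obtain i j where ij: "X = {i, j}" "i \<noteq> j" using X by (auto simp: card_2_iff)
  have *: "\<exists>v\<in>V. x \<in> T v \<and> c v \<le> (\<Sum>v\<in>{v\<in>V. x \<in> T v}. w v * c v)" if "x \<in> X" for x
  proof -
    have ge: "1 \<le> (\<Sum>v\<in>{v\<in>V. x \<in> T v}. w v)" using w that by (rule fractional_coverD)
    obtain v where v: "v \<in> V" "x \<in> T v" "c v * (\<Sum>v\<in>{v\<in>V. x \<in> T v}. w v) \<le> (\<Sum>v\<in>{v\<in>V. x \<in> T v}. w v * c v)"
      using cheapest_set[of "{v\<in>V. x \<in> T v}" w c] ge V fractional_coverD(1)[OF w] by force
    moreover have "c v * 1 \<le> c v * (\<Sum>v\<in>{v\<in>V. x \<in> T v}. w v)" using ge c v by (intro mult_left_mono) auto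
    ultimately show ?thesis by force
  qed
  obtain u v where u: "u \<in> V" "i \<in> T u" "c u \<le> (\<Sum>v\<in>{v\<in>V. i \<in> T v}. w v * c v)"
    and v: "v \<in> V" "j \<in> T v" "c v \<le> (\<Sum>v\<in>{v\<in>V. j \<in> T v}. w v * c v)"
    using *[of i] *[of j] ij by blast
  have disj: "{v\<in>V. i \<in> T v} \<inter> {v\<in>V. j \<in> T v} = {}" using full ij by auto
  have "sum c {u, v} \<le> (\<Sum>v\<in>{v\<in>V. i \<in> T v}. w v * c v) + (\<Sum>v\<in>{v\<in>V. j \<in> T v}. w v * c v)"
    using u v full[of u] ij by (cases "u = v") auto
  also have "\<dots> = (\<Sum>v\<in>{v\<in>V. i \<in> T v} \<union> {v\<in>V. j \<in> T v}. w v * c v)"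
    using V disj by (intro sum.union_disjoint[symmetric]) auto
  also have "\<dots> \<le> (\<Sum>v\<in>V. w v * c v)"
    using V c fractional_coverD(1)[OF w] by (intro sum_mono2) auto
  finally show "\<exists>D\<subseteq>V. X \<subseteq> (\<Union>v\<in>D. T v) \<and> sum c D \<le> 1 * (\<Sum>v\<in>V. w v * c v)"
    using u v ij by (intro exI[of _ "{u, v}"]) auto
qed

text \<open>
  Write \<open>F\<close> for the cost of the fractional cover, and suppose that all integral covers cost more than
  \<open>\<rho> F\<close>. The elements outside a set \<open>v\<close> with \<open>b\<close> elements in \<open>X\<close> can be covered at cost at most
  \<open>\<sigma> v (F - w v c v)\<close> with \<open>\<sigma> v = r (k - b)\<close>, since \<open>v\<close> itself is useless there; therefore
  \<open>\<rho> F < c v + \<sigma> v (F - w v c v)\<close>. Multiplication with \<open>g v = w v / (1 - \<sigma> v w v)\<close> turns the coefficient of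
  \<open>c v\<close> into \<open>w v\<close>, so summation over \<open>v\<close> gives \<open>F (\<Sum>v. (\<rho> - \<sigma> v) g v) < F\<close>. This is absurd if the sum is
  at least 1, and \<open>tangent\<close> guarantees that: it bounds every summand from below by the affine
  expression \<open>(\<beta> + 1 / k) b (w v) - \<beta>\<close>; the numbers \<open>b (w v)\<close> sum up to at least \<open>k\<close>, and there are at most
  \<open>k\<close> summands.
  
  In the application \<open>\<rho> = 2 (k - 1) / k\<close> and \<open>\<beta> = 1 / (k (k - 2))\<close>. This choice makes the affine expression for
  \<open>b = k - 1\<close> the tangent at \<open>1 / (k - 1)\<close>, the weight in the extremal example.
\<close>

lemma cover_gap_step:
  fixes r :: "nat \<Rightarrow> real"
  assumes k: "k > 0" and \<rho>: "1 \<le> \<rho>" and \<beta>: "0 \<le> \<beta>"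
    and gap: "\<And>j. 0 < j \<Longrightarrow> j < k \<Longrightarrow> cover_gap TYPE('i) TYPE('v) j (r j)"
    and r: "\<And>j. 0 < j \<Longrightarrow> j < k \<Longrightarrow> 0 \<le> r j \<and> r j \<le> \<rho>"
    and tangent: "\<And>b x. 0 < b \<Longrightarrow> b < k \<Longrightarrow> 0 < x \<Longrightarrow> r (k - b) * x < 1 \<Longrightarrow>
      ((\<beta> + 1 / k) * b * x - \<beta>) * (1 - r (k - b) * x) \<le> (\<rho> - r (k - b)) * x"
  shows "cover_gap TYPE('i) TYPE('v) k \<rho>"
proof (rule cover_gap_if_no_full_set[OF \<rho> k])
  fix X :: "'i set" and V0 :: "'v set" and T and c w0 :: "'v \<Rightarrow> real"
  assume X: "finite X" "card X = k" and V0: "finite V0" and c0: "\<And>v. v \<in> V0 \<Longrightarrow> 0 \<le> c v"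
    and full: "\<And>v. v \<in> V0 \<Longrightarrow> \<not> X \<subseteq> T v" and w0: "fractional_cover X V0 T w0"
  define V1 where "V1 = {v\<in>V0. T v \<inter> X \<noteq> {}}"
  have V1: "finite V1" "\<And>v. v \<in> V1 \<Longrightarrow> T v \<inter> X \<noteq> {}" "V1 \<subseteq> V0" using V0 by (auto simp: V1_def)
  have w1: "fractional_cover X V1 T w0"
    by (rule fractional_cover_subset[OF w0 V0]) (auto simp: V1_def)
  obtain w where w: "fractional_cover X V1 T w" "card {v\<in>V1. w v \<noteq> 0} \<le> k"
    "(\<Sum>v\<in>V1. w v * c v) \<le> (\<Sum>v\<in>V1. w0 v * c v)"
    using sparse_fractional_cover[OF X(1) V1(1,2) w1, of c] X by blast
  define V where "V = {v\<in>V1. w v \<noteq> 0}"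
  have V: "finite V" "V \<subseteq> V0" "card V \<le> k" using V1 w by (auto simp: V_def)
  have wV: "fractional_cover X V T w"
    by (rule fractional_cover_subset[OF w(1) V1(1)]) (auto simp: V_def)
  have w_pos: "0 < w v" if "v \<in> V" for v
    using that fractional_coverD(1)[OF w(1)] by (force simp: V_def)
  have c: "0 \<le> c v" if "v \<in> V" for v using that c0 V by auto
  define F where "F = (\<Sum>v\<in>V. w v * c v)"
  have "F = (\<Sum>v\<in>V1. w v * c v)"
    unfolding F_def using V1 by (intro sum.mono_neutral_left) (auto simp: V_def)
  also have "\<dots> \<le> (\<Sum>v\<in>V1. w0 v * c v)" by (fact w(3))
  also have "\<dots> \<le> (\<Sum>v\<in>V0. w0 v * c v)"
    using V0 V1 c0 fractional_coverD(1)[OF w0] by (intro sum_mono2) auto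
  finally have F_le: "F \<le> (\<Sum>v\<in>V0. w0 v * c v)" .
  have F0: "0 \<le> F" unfolding F_def using c w_pos by (force intro!: sum_nonneg)
  have "\<exists>D\<subseteq>V. X \<subseteq> (\<Union>v\<in>D. T v) \<and> sum c D \<le> \<rho> * F"
  proof (rule ccontr)
    assume "\<not> ?thesis"
    then have dear: "\<rho> * F < sum c D" if "D \<subseteq> V" "X \<subseteq> (\<Union>v\<in>D. T v)" for D
      using that by force
    define b where "b v = card (T v \<inter> X)" for v
    define \<sigma> where "\<sigma> v = r (k - b v)" for v
    have b: "0 < b v" "b v < k" if "v \<in> V" for v
    proof -
      show "0 < b v" using that V1 X by (auto simp: b_def V_def card_gt_0_iff)
      have "T v \<inter> X \<subset> X" using that full V by blast
      then show "b v < k" using X by (auto simp: b_def intro: psubset_card_mono)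
    qed
    have \<sigma>: "0 \<le> \<sigma> v" "\<sigma> v \<le> \<rho>" if "v \<in> V" for v
      using b[OF that] r[of "k - b v"] by (auto simp: \<sigma>_def)
    have complete: "\<rho> * F < c v + \<sigma> v * (F - w v * c v)" if v: "v \<in> V" for v
    proof -
      define Y where "Y = X - T v"
      have Y: "finite Y" "card Y = k - b v"
        using X card_Diff_subset_Int[of X "T v"] by (auto simp: Y_def b_def Int_commute)
      define V' where "V' = {u\<in>V. T u \<inter> Y \<noteq> {}}"
      have V': "finite V'" "V' \<subseteq> V - {v}" using V by (auto simp: V'_def Y_def)
      have wY: "fractional_cover Y V' T w"
        by (rule fractional_cover_subset[OF wV V(1)]) (auto simp: V'_def Y_def)
      have cV': "0 \<le> c u" if "u \<in> V'" for u using that V'(2) c by blast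
      have gapY: "cover_gap TYPE('i) TYPE('v) (k - b v) (\<sigma> v)"
        using gap[of "k - b v"] b[OF v] by (simp add: \<sigma>_def)
      obtain D where D: "D \<subseteq> V'" "Y \<subseteq> (\<Union>v\<in>D. T v)" "sum c D \<le> \<sigma> v * (\<Sum>u\<in>V'. w u * c u)"
        by (rule cover_gapD[OF gapY Y V'(1) cV' wY])
      have "X \<subseteq> (\<Union>u\<in>insert v D. T u)" using D by (auto simp: Y_def)
      then have "\<rho> * F < sum c (insert v D)" using dear[of "insert v D"] v D V' by auto
      also have "\<dots> \<le> c v + sum c D"
        using D V' by (subst sum.insert) (auto intro: finite_subset)
      finally have "\<rho> * F < c v + sum c D" .
      moreover have "(\<Sum>u\<in>V'. w u * c u) \<le> F - w v * c v"
      proof -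
        have "(\<Sum>u\<in>V'. w u * c u) \<le> (\<Sum>u\<in>V - {v}. w u * c u)"
          using V V' c w_pos by (intro sum_mono2) (auto simp: less_imp_le)
        also have "\<dots> = F - w v * c v"
          unfolding F_def using V v by (subst sum_diff1) auto
        finally show ?thesis .
      qed
      then have "\<sigma> v * (\<Sum>u\<in>V'. w u * c u) \<le> \<sigma> v * (F - w v * c v)"
        using \<sigma>[OF v] by (intro mult_left_mono)
      ultimately show ?thesis using D(3) by linarith
    qed
    \<comment> \<open>If \<open>\<sigma> v * w v\<close> is at least 1, the completion of \<open>v\<close> alone costs at most \<open>\<sigma> v * F\<close>.\<close>
    have small: "\<sigma> v * w v < 1" if v: "v \<in> V" for v
    proof (rule ccontr)
      assume "\<not> ?thesis"
      then have "c v * (1 - \<sigma> v * w v) \<le> 0" using c[OF v] by (intro mult_nonneg_nonpos) auto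
      then have "c v + \<sigma> v * (F - w v * c v) \<le> \<sigma> v * F" by (simp add: algebra_simps)
      also have "\<dots> \<le> \<rho> * F" using \<sigma>[OF v] F0 by (intro mult_right_mono) auto
      finally show False using complete[OF v] by simp
    qed
    define g where "g v = w v / (1 - \<sigma> v * w v)" for v
    have g: "0 < g v" "g v * (1 - \<sigma> v * w v) = w v" if "v \<in> V" for v
      using small[OF that] w_pos[OF that] by (auto simp: g_def)
    have "V \<noteq> {}"
    proof
      assume "V = {}"
      moreover obtain i where "i \<in> X" using X k by fastforce
      ultimately show False using fractional_coverD(2)[OF wV, of i] by simp
    qed
    have "(\<Sum>v\<in>V. g v * (\<rho> * F)) < (\<Sum>v\<in>V. g v * (c v + \<sigma> v * (F - w v * c v)))"
      using V \<open>V \<noteq> {}\<close> complete g by (intro sum_strict_mono) auto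
    also have "\<dots> = (\<Sum>v\<in>V. w v * c v + g v * \<sigma> v * F)"
    proof (rule sum.cong)
      fix v assume "v \<in> V"
      have "g v * (c v + \<sigma> v * (F - w v * c v)) = g v * (1 - \<sigma> v * w v) * c v + g v * \<sigma> v * F"
        by (simp add: algebra_simps)
      then show "g v * (c v + \<sigma> v * (F - w v * c v)) = w v * c v + g v * \<sigma> v * F"
        using g(2)[OF \<open>v \<in> V\<close>] by simp
    qed simp
    also have "\<dots> = F + (\<Sum>v\<in>V. g v * \<sigma> v * F)" by (simp add: sum.distrib F_def)
    finally have "(\<Sum>v\<in>V. g v * (\<rho> * F)) - (\<Sum>v\<in>V. g v * \<sigma> v * F) < F" by simp
    also have "(\<Sum>v\<in>V. g v * (\<rho> * F)) - (\<Sum>v\<in>V. g v * \<sigma> v * F) = (\<Sum>v\<in>V. (\<rho> - \<sigma> v) * g v) * F"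
      unfolding sum_subtractf[symmetric] sum_distrib_right by (intro sum.cong) (auto simp: algebra_simps)
    finally have "(\<Sum>v\<in>V. (\<rho> - \<sigma> v) * g v) * F < F" .
    moreover have "1 \<le> (\<Sum>v\<in>V. (\<rho> - \<sigma> v) * g v)"
    proof -
      have "real k = (\<Sum>i\<in>X. 1)" using X by simp
      also have "\<dots> \<le> (\<Sum>i\<in>X. \<Sum>v\<in>{v\<in>V. i \<in> T v}. w v)"
        using fractional_coverD(2)[OF wV] by (intro sum_mono)
      also have "\<dots> = (\<Sum>v\<in>V. \<Sum>i\<in>{i\<in>X. i \<in> T v}. w v)"
        using X V by (intro sum.swap_restrict)
      also have "\<dots> = (\<Sum>v\<in>V. b v * w v)"
        by (intro sum.cong) (auto simp: b_def Int_def conj_commute)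
      finally have size: "real k \<le> (\<Sum>v\<in>V. b v * w v)" .
      have "1 = (\<beta> + 1 / k) * k - k * \<beta>" using k by (simp add: field_simps)
      also have "\<dots> \<le> (\<beta> + 1 / k) * (\<Sum>v\<in>V. b v * w v) - card V * \<beta>"
        using size V \<beta> by (intro diff_mono mult_left_mono mult_right_mono) auto
      also have "\<dots> = (\<Sum>v\<in>V. (\<beta> + 1 / k) * b v * w v - \<beta>)"
        by (simp add: sum_subtractf sum_distrib_left mult.assoc)
      also have "\<dots> \<le> (\<Sum>v\<in>V. (\<rho> - \<sigma> v) * g v)"
      proof (rule sum_mono)
        fix v assume v: "v \<in> V"
        have "((\<beta> + 1 / k) * b v * w v - \<beta>) * (1 - \<sigma> v * w v) \<le> (\<rho> - \<sigma> v) * w v"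
          unfolding \<sigma>_def using tangent b[OF v] w_pos[OF v] small[OF v] by (simp add: \<sigma>_def)
        then show "(\<beta> + 1 / k) * b v * w v - \<beta> \<le> (\<rho> - \<sigma> v) * g v"
          using small[OF v] by (simp add: g_def pos_le_divide_eq)
      qed
      finally show ?thesis .
    qed
    then have "1 * F \<le> (\<Sum>v\<in>V. (\<rho> - \<sigma> v) * g v) * F" using F0 by (rule mult_right_mono)
    ultimately show False by simp
  qed
  then obtain D where D: "D \<subseteq> V" "X \<subseteq> (\<Union>v\<in>D. T v)" "sum c D \<le> \<rho> * F" by blast
  moreover have "\<rho> * F \<le> \<rho> * (\<Sum>v\<in>V0. w0 v * c v)" using F_le \<rho> by (intro mult_left_mono) auto
  ultimately show "\<exists>D\<subseteq>V0. X \<subseteq> (\<Union>v\<in>D. T v) \<and> sum c D \<le> \<rho> * (\<Sum>v\<in>V0. w0 v * c v)"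
    using V by (intro exI[of _ D]) auto
qed

text \<open>
  For \<open>k = 3, 4, 5\<close> the inequality \<open>tangent\<close> is quadratic in \<open>x\<close>. After clearing denominators, it follows
  from the square of \<open>x - x\<^sub>0\<close> being nonnegative, where \<open>x\<^sub>0\<close> is the minimiser of the quadratic.
\<close>

lemma cover_gap_3: "cover_gap TYPE('i) TYPE('v) 3 (4/3)"
proof (rule cover_gap_step[where \<beta> = "1/3" and r = "\<lambda>_. 1"])
  fix j :: nat assume "0 < j" "j < 3"
  then consider "j = 1" | "j = 2" by linarith
  then show "cover_gap TYPE('i) TYPE('v) j 1" using cover_gap_1 cover_gap_2 by cases auto
next
  fix b :: nat and x :: real assume "0 < b" "b < 3"
  then consider "b = 1" | "b = 2" by linarith
  then show "((1 / 3 + 1 / real 3) * real b * x - 1 / 3) * (1 - 1 * x) \<le> (4 / 3 - 1) * x"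
  proof cases
    case 1
    have "0 \<le> (x - 1/2)\<^sup>2" by simp
    with 1 show ?thesis by (simp add: power2_eq_square field_simps)
  next
    case 2
    have "0 \<le> (x - 1/2)\<^sup>2" by simp
    with 2 show ?thesis by (simp add: power2_eq_square field_simps)
  qed
qed auto

lemma cover_gap_4: "cover_gap TYPE('i) TYPE('v) 4 (3/2)"
proof (rule cover_gap_step[where \<beta> = "1/8" and r = "\<lambda>j. if j = 3 then 4/3 else 1"])
  fix j :: nat assume "0 < j" "j < 4"
  then consider "j = 1" | "j = 2" | "j = 3" by linarith
  then show "cover_gap TYPE('i) TYPE('v) j (if j = 3 then 4/3 else 1)"
    using cover_gap_1 cover_gap_2 cover_gap_3 by cases auto
next
  fix b :: nat and x :: real assume "0 < b" "b < 4"
  then consider "b = 1" | "b = 2" | "b = 3" by linarith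
  then show "((1 / 8 + 1 / real 4) * real b * x - 1 / 8) * (1 - (if 4 - b = 3 then 4/3 else 1) * x)
      \<le> (3 / 2 - (if 4 - b = 3 then 4/3 else 1)) * x"
  proof cases
    case 1
    have "0 \<le> (x - 3/8)\<^sup>2" by simp
    with 1 show ?thesis by (simp add: power2_eq_square field_simps)
  next
    case 2
    have "0 \<le> (x - 1/4)\<^sup>2" by simp
    with 2 show ?thesis by (simp add: power2_eq_square field_simps)
  next
    case 3
    have "0 \<le> (x - 1/3)\<^sup>2" by simp
    with 3 show ?thesis by (simp add: power2_eq_square field_simps)
  qed
qed auto

lemma cover_gap_5: "cover_gap TYPE('i) TYPE('v) 5 (8/5)"
proof (rule cover_gap_step[where \<beta> = "1/15" and r = "\<lambda>j. if j = 4 then 3/2 else if j = 3 then 4/3 else 1"])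
  fix j :: nat assume "0 < j" "j < 5"
  then consider "j = 1" | "j = 2" | "j = 3" | "j = 4" by linarith
  then show "cover_gap TYPE('i) TYPE('v) j (if j = 4 then 3/2 else if j = 3 then 4/3 else 1)"
    using cover_gap_1 cover_gap_2 cover_gap_3 cover_gap_4 by cases auto
next
  fix b :: nat and x :: real assume "0 < b" "b < 5"
  then consider "b = 1" | "b = 2" | "b = 3" | "b = 4" by linarith
  then show "((1 / 15 + 1 / real 5) * real b * x - 1 / 15) *
        (1 - (if 5 - b = 4 then 3/2 else if 5 - b = 3 then 4/3 else 1) * x)
      \<le> (8 / 5 - (if 5 - b = 4 then 3/2 else if 5 - b = 3 then 4/3 else 1)) * x"
  proof cases
    case 1
    have "0 \<le> (x - 1/3)\<^sup>2" by simp
    with 1 show ?thesis by (simp add: power2_eq_square field_simps)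
  next
    case 2
    have "0 \<le> (x - 1/4)\<^sup>2" by simp
    with 2 show ?thesis by (simp add: power2_eq_square field_simps)
  next
    case 3
    have "0 \<le> (x - 1/6)\<^sup>2" by simp
    with 3 show ?thesis by (simp add: power2_eq_square field_simps)
  next
    case 4
    have "0 \<le> (x - 1/4)\<^sup>2" by simp
    with 4 show ?thesis by (simp add: power2_eq_square field_simps)
  qed
qed auto

section \<open>Fractional covers and packings: linear programming duality\<close>

text \<open>
  A pair \<open>(a, b)\<close> stands for the linear inequality \<open>(\<Sum>i. a i * x i) \<le> b\<close>; the closure consists of the
  inequalities that follow from \<open>S\<close> by nonnegative linear combination.
\<close>

inductive_set conic_closure :: "(('i \<Rightarrow> real) \<times> real) set \<Rightarrow> (('i \<Rightarrow> real) \<times> real) set"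
  for S where
  base: "(a, b) \<in> S \<Longrightarrow> (a, b) \<in> conic_closure S"
| add: "(a, b) \<in> conic_closure S \<Longrightarrow> (a', b') \<in> conic_closure S \<Longrightarrow> (\<lambda>i. a i + a' i, b + b') \<in> conic_closure S"
| scale: "0 \<le> t \<Longrightarrow> (a, b) \<in> conic_closure S \<Longrightarrow> (\<lambda>i. t * a i, t * b) \<in> conic_closure S"

lemma conic_closure_subset:
  assumes "S' \<subseteq> conic_closure S" "(a, b) \<in> conic_closure S'"
  shows "(a, b) \<in> conic_closure S"
  using assms(2)
proof (induction rule: conic_closure.induct)
  case (base a b) then show ?case using assms(1) by blast
qed (auto intro: conic_closure.intros)

lemma conic_closure_coordinate_zero:
  assumes "(a, b) \<in> conic_closure S" "\<And>a b. (a, b) \<in> S \<Longrightarrow> a i = 0"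
  shows "a i = 0"
  using assms(1) by (induction rule: conic_closure.induct) (auto intro: assms(2))

lemma real_between_finite_sets:
  fixes A B :: "real set"
  assumes "finite A" "finite B" "\<And>a b. a \<in> A \<Longrightarrow> b \<in> B \<Longrightarrow> a \<le> b"
  shows "\<exists>y. (\<forall>a\<in>A. a \<le> y) \<and> (\<forall>b\<in>B. y \<le> b)"
proof (cases "A = {}")
  case True
  show ?thesis
  proof (cases "B = {}")
    case True with \<open>A = {}\<close> show ?thesis by auto
  next
    case False
    then have "\<forall>b\<in>B. Min B \<le> b" using assms by auto
    with True show ?thesis by auto
  qed
next
  case False
  then have "(\<forall>a\<in>A. a \<le> Max A) \<and> (\<forall>b\<in>B. Max A \<le> b)" using assms by auto
  then show ?thesis by blast
qed

text \<open>
  Farkas' lemma by Fourier-Motzkin elimination. Adding multiples of an inequality in which the unknown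
  \<open>i\<close> has a positive coefficient and one in which it has a negative coefficient eliminates \<open>i\<close>. If the
  eliminated system has a solution, it extends to the unknown \<open>i\<close>, because every lower bound for \<open>x i\<close>
  is at most every upper bound.
\<close>

lemma farkas:
  fixes S :: "(('i \<Rightarrow> real) \<times> real) set"
  assumes "finite N" "finite S" "\<nexists>x. \<forall>(a, b)\<in>S. (\<Sum>i\<in>N. a i * x i) \<le> b"
  shows "\<exists>a b. (a, b) \<in> conic_closure S \<and> (\<forall>i\<in>N. a i = 0) \<and> b < 0"
  using assms
proof (induction N arbitrary: S rule: finite_induct)
  case empty
  then obtain a b where "(a, b) \<in> S" "b < 0" by force
  then show ?case by (auto intro: conic_closure.base)
next
  case (insert i N)
  define Z where "Z = {p \<in> S. fst p i = 0}"
  define P where "P = {p \<in> S. fst p i > 0}"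
  define M where "M = {p \<in> S. fst p i < 0}"
  have fin: "finite Z" "finite P" "finite M" using insert.prems by (auto simp: Z_def P_def M_def)
  have S: "S = Z \<union> P \<union> M" by (auto simp: Z_def P_def M_def)
  define elim :: "(('i \<Rightarrow> real) \<times> real) \<times> (('i \<Rightarrow> real) \<times> real) \<Rightarrow> ('i \<Rightarrow> real) \<times> real"
    where "elim = (\<lambda>(p, m). (\<lambda>j. fst p j / fst p i - fst m j / fst m i, snd p / fst p i - snd m / fst m i))"
  define S' where "S' = Z \<union> elim ` (P \<times> M)"
  have "finite S'" using fin by (auto simp: S'_def)
  have sub: "S' \<subseteq> conic_closure S"
  proof -
    have "elim (p, m) \<in> conic_closure S" if "p \<in> P" "m \<in> M" for p m
    proof -
      have 1: "(\<lambda>j. (1 / fst p i) * fst p j, (1 / fst p i) * snd p) \<in> conic_closure S"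
        using that by (intro conic_closure.scale conic_closure.base) (auto simp: P_def)
      have 2: "(\<lambda>j. (- 1 / fst m i) * fst m j, (- 1 / fst m i) * snd m) \<in> conic_closure S"
        using that by (intro conic_closure.scale conic_closure.base) (auto simp: M_def divide_nonneg_neg)
      show ?thesis using conic_closure.add[OF 1 2] by (simp add: elim_def)
    qed
    moreover have "Z \<subseteq> conic_closure S" by (auto simp: Z_def intro: conic_closure.base)
    ultimately show ?thesis by (auto simp: S'_def)
  qed
  have zero: "a i = 0" if "(a, b) \<in> S'" for a b
    using that by (auto simp: S'_def Z_def P_def M_def elim_def)
  have "\<nexists>x. \<forall>(a, b)\<in>S'. (\<Sum>j\<in>N. a j * x j) \<le> b"
  proof
    assume "\<exists>x. \<forall>(a, b)\<in>S'. (\<Sum>j\<in>N. a j * x j) \<le> b"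
    then obtain x where x: "\<And>a b. (a, b) \<in> S' \<Longrightarrow> (\<Sum>j\<in>N. a j * x j) \<le> b" by blast
    define bound where "bound p = (snd p - (\<Sum>j\<in>N. fst p j * x j)) / fst p i" for p
    have le: "bound m \<le> bound p" if "p \<in> P" "m \<in> M" for p m
    proof -
      have "elim (p, m) \<in> S'" using that by (auto simp: S'_def)
      then have "(\<Sum>j\<in>N. (fst p j / fst p i - fst m j / fst m i) * x j) \<le> snd p / fst p i - snd m / fst m i"
        unfolding elim_def prod.case by (rule x)
      also have "(\<Sum>j\<in>N. (fst p j / fst p i - fst m j / fst m i) * x j) =
          (\<Sum>j\<in>N. fst p j * x j) / fst p i - (\<Sum>j\<in>N. fst m j * x j) / fst m i"
        by (simp add: left_diff_distrib sum_subtractf sum_divide_distrib)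
      finally show ?thesis by (simp add: bound_def diff_divide_distrib)
    qed
    obtain y where y: "\<And>m. m \<in> M \<Longrightarrow> bound m \<le> y" "\<And>p. p \<in> P \<Longrightarrow> y \<le> bound p"
      using real_between_finite_sets[of "bound ` M" "bound ` P"] fin le by fast
    have "(\<Sum>j\<in>insert i N. a j * (x(i := y)) j) \<le> b" if ab: "(a, b) \<in> S" for a b
    proof -
      have "(\<Sum>j\<in>insert i N. a j * (x(i := y)) j) = a i * y + (\<Sum>j\<in>N. a j * x j)"
        using insert.hyps by (auto intro!: sum.cong)
      moreover have "a i * y + (\<Sum>j\<in>N. a j * x j) \<le> b"
      proof -
        consider "(a, b) \<in> Z" | "(a, b) \<in> P" | "(a, b) \<in> M" using ab S by blast
        then show ?thesis
        proof cases
          case 1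
          then show ?thesis using x[of a b] by (simp add: Z_def S'_def)
        next
          case 2
          then show ?thesis using y(2)[OF 2] by (simp add: P_def bound_def field_simps)
        next
          case 3
          then show ?thesis using y(1)[OF 3] by (simp add: M_def bound_def field_simps)
        qed
      qed
      ultimately show ?thesis by simp
    qed
    then show False using insert.prems by blast
  qed
  from insert.IH[OF \<open>finite S'\<close> this] obtain a b where
    ab: "(a, b) \<in> conic_closure S'" "\<forall>j\<in>N. a j = 0" "b < 0" by blast
  have "a i = 0" using ab(1) zero by (rule conic_closure_coordinate_zero)
  then show ?case using ab conic_closure_subset[OF sub ab(1)] by blast
qed

text \<open>
  The duality between covering and packing. The packing sought is a solution of the system \<open>S\<close> below. If
  there is none, Farkas' lemma provides multipliers: those of the capacity constraints, divided by the
  multiplier \<open>z\<close> of the size constraint, form a fractional cover of cost less than \<open>\<sigma>\<close>.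
\<close>

lemma fractional_packing_if_covers_expensive:
  fixes T :: "'v \<Rightarrow> 'i set" and c :: "'v \<Rightarrow> real"
  assumes X: "finite X" and V: "finite V" and c: "\<And>v. v \<in> V \<Longrightarrow> 0 \<le> c v"
    and covers: "\<And>w. fractional_cover X V T w \<Longrightarrow> \<sigma> \<le> (\<Sum>v\<in>V. w v * c v)"
  shows "\<exists>l. (\<forall>i\<in>X. 0 \<le> l i) \<and> \<sigma> \<le> sum l X \<and> (\<forall>v\<in>V. sum l (X \<inter> T v) \<le> c v)"
proof (rule ccontr)
  assume no: "\<not> ?thesis"
  define S where "S = (\<lambda>j. (\<lambda>i. - of_bool (i = j), 0)) ` X \<union> (\<lambda>v. (\<lambda>i. of_bool (i \<in> T v), c v)) ` V
     \<union> {(\<lambda>_ :: 'i. - 1 :: real, - \<sigma>)}"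
  have "finite S" using X V by (auto simp: S_def)
  have "\<nexists>x. \<forall>(a, b)\<in>S. (\<Sum>i\<in>X. a i * x i) \<le> b"
  proof
    assume "\<exists>x. \<forall>(a, b)\<in>S. (\<Sum>i\<in>X. a i * x i) \<le> b"
    then obtain x where x: "\<And>a b. (a, b) \<in> S \<Longrightarrow> (\<Sum>i\<in>X. a i * x i) \<le> b" by blast
    have "0 \<le> x j" if "j \<in> X" for j
    proof -
      have "(\<Sum>i\<in>X. - of_bool (i = j) * x i) \<le> 0" by (rule x) (use that in \<open>auto simp: S_def\<close>)
      then show ?thesis using that X by (simp add: sum_negf of_bool_def if_distrib[of "\<lambda>y. y * _"] cong: if_cong)
    qed
    moreover have "sum x (X \<inter> T v) \<le> c v" if "v \<in> V" for v
    proof -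
      have "(\<Sum>i\<in>X. of_bool (i \<in> T v) * x i) \<le> c v" by (rule x) (use that in \<open>auto simp: S_def\<close>)
      also have "(\<Sum>i\<in>X. of_bool (i \<in> T v) * x i) = sum x (X \<inter> T v)"
        unfolding sum.inter_restrict[OF X] by (intro sum.cong) auto
      finally show ?thesis .
    qed
    moreover have "\<sigma> \<le> sum x X"
    proof -
      have "(\<Sum>i\<in>X. - 1 * x i) \<le> - \<sigma>" by (rule x) (auto simp: S_def)
      then show ?thesis by (simp add: sum_negf)
    qed
    ultimately show False using no by blast
  qed
  from farkas[OF X \<open>finite S\<close> this] obtain a b where
    ab: "(a, b) \<in> conic_closure S" "\<forall>i\<in>X. a i = 0" "b < 0" by blast
  have "\<exists>w z. (\<forall>v\<in>V. 0 \<le> w v) \<and> 0 \<le> z \<and> (\<forall>i\<in>X. a i \<le> (\<Sum>v\<in>{v\<in>V. i \<in> T v}. w v) - z)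
      \<and> b = (\<Sum>v\<in>V. w v * c v) - z * \<sigma>"
    using ab(1)
  proof (induction rule: conic_closure.induct)
    case (base a b)
    then consider j where "j \<in> X" "a = (\<lambda>i. - of_bool (i = j))" "b = 0"
      | u where "u \<in> V" "a = (\<lambda>i. of_bool (i \<in> T u))" "b = c u"
      | "a = (\<lambda>_. - 1)" "b = - \<sigma>"
      by (auto simp: S_def)
    then show ?case
    proof cases
      case 1
      then show ?thesis by (intro exI[of _ "\<lambda>_. 0"] exI[of _ 0]) auto
    next
      case 2
      have "(\<Sum>v\<in>V. of_bool (v = u) * c v) = c u"
        using 2 V by (simp add: of_bool_def if_distrib[of "\<lambda>y. y * _"] cong: if_cong)
      moreover have "of_bool (i \<in> T u) \<le> (\<Sum>v\<in>{v\<in>V. i \<in> T v}. of_bool (v = u) :: real)" for i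
        using 2 V by (auto simp: of_bool_def)
      ultimately show ?thesis using 2
        by (intro exI[of _ "\<lambda>v. of_bool (v = u)"] exI[of _ 0]) auto
    next
      case 3
      then show ?thesis by (intro exI[of _ "\<lambda>_. 0"] exI[of _ 1]) auto
    qed
  next
    case (add a b a' b')
    from add.IH obtain w z w' z' where
      "(\<forall>v\<in>V. 0 \<le> w v) \<and> 0 \<le> z \<and> (\<forall>i\<in>X. a i \<le> (\<Sum>v\<in>{v\<in>V. i \<in> T v}. w v) - z) \<and> b = (\<Sum>v\<in>V. w v * c v) - z * \<sigma>"
      "(\<forall>v\<in>V. 0 \<le> w' v) \<and> 0 \<le> z' \<and> (\<forall>i\<in>X. a' i \<le> (\<Sum>v\<in>{v\<in>V. i \<in> T v}. w' v) - z') \<and> b' = (\<Sum>v\<in>V. w' v * c v) - z' * \<sigma>"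
      by blast
    then show ?case
      by (intro exI[of _ "\<lambda>v. w v + w' v"] exI[of _ "z + z'"]) (force simp: sum.distrib algebra_simps)
  next
    case (scale t a b)
    from scale.IH obtain w z where
      wz: "\<forall>v\<in>V. 0 \<le> w v" "0 \<le> z" "\<forall>i\<in>X. a i \<le> (\<Sum>v\<in>{v\<in>V. i \<in> T v}. w v) - z" "b = (\<Sum>v\<in>V. w v * c v) - z * \<sigma>"
      by blast
    have "t * a i \<le> (\<Sum>v\<in>{v\<in>V. i \<in> T v}. t * w v) - t * z" if "i \<in> X" for i
    proof -
      have "t * a i \<le> t * ((\<Sum>v\<in>{v\<in>V. i \<in> T v}. w v) - z)" using wz(3) that scale.hyps(1) by (intro mult_left_mono) auto
      then show ?thesis by (simp add: algebra_simps sum_distrib_left)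
    qed
    moreover have "t * b = (\<Sum>v\<in>V. t * w v * c v) - t * z * \<sigma>"
      by (simp add: wz(4) right_diff_distrib sum_distrib_left mult.assoc)
    ultimately show ?case using wz(1,2) scale.hyps(1)
      by (intro exI[of _ "\<lambda>v. t * w v"] exI[of _ "t * z"]) auto
  qed
  then obtain w z where w: "\<forall>v\<in>V. 0 \<le> w v" and z: "0 \<le> z"
    and le: "\<forall>i\<in>X. z \<le> (\<Sum>v\<in>{v\<in>V. i \<in> T v}. w v)" and lt: "(\<Sum>v\<in>V. w v * c v) < z * \<sigma>"
    using ab(2,3) by force
  have "0 \<le> (\<Sum>v\<in>V. w v * c v)" using w c by (intro sum_nonneg) auto
  then have "0 < z" using z lt by (cases "z = 0") auto
  have "fractional_cover X V T (\<lambda>v. w v / z)"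
    using w le \<open>0 < z\<close> by (auto simp: fractional_cover_def sum_divide_distrib[symmetric])
  from covers[OF this] have "\<sigma> \<le> (\<Sum>v\<in>V. w v * c v) / z" by (simp add: sum_divide_distrib)
  then show False using lt \<open>0 < z\<close> by (simp add: field_simps)
qed

text \<open>
  The gap bound makes fractional covers cost at least \<open>s / \<rho>\<close>, so that there is a real packing of this
  size. Rounding it down loses less than 1 at each element.
\<close>

lemma integral_packing_if_covers_expensive:
  fixes T :: "'v \<Rightarrow> 'i set" and m :: "'v \<Rightarrow> nat"
  assumes gap: "cover_gap TYPE('i) TYPE('v) (card X) \<rho>" and \<rho>: "0 < \<rho>"
    and X: "finite X" and V: "finite V"
    and covers: "\<And>D. D \<subseteq> V \<Longrightarrow> X \<subseteq> (\<Union>v\<in>D. T v) \<Longrightarrow> s \<le> sum m D"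
  shows "\<exists>n :: 'i \<Rightarrow> nat. real s / \<rho> - card X \<le> real (sum n X) \<and> (\<forall>v\<in>V. sum n (X \<inter> T v) \<le> m v)"
proof -
  have "real s / \<rho> \<le> (\<Sum>v\<in>V. w v * real (m v))" if w: "fractional_cover X V T w" for w
  proof -
    obtain D where D: "D \<subseteq> V" "X \<subseteq> (\<Union>v\<in>D. T v)" "(\<Sum>v\<in>D. real (m v)) \<le> \<rho> * (\<Sum>v\<in>V. w v * real (m v))"
      by (rule cover_gapD[OF gap X refl V _ w, of "\<lambda>v. real (m v)"]) auto
    have "real s \<le> (\<Sum>v\<in>D. real (m v))" using covers[OF D(1,2)] by (metis of_nat_le_iff of_nat_sum)
    then show ?thesis using D(3) \<rho> by (simp add: field_simps)
  qed
  then have "\<exists>l. (\<forall>i\<in>X. 0 \<le> l i) \<and> real s / \<rho> \<le> sum l X \<and> (\<forall>v\<in>V. sum l (X \<inter> T v) \<le> real (m v))"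
    by (intro fractional_packing_if_covers_expensive[OF X V]) auto
  then obtain l where l: "\<forall>i\<in>X. 0 \<le> l i" "real s / \<rho> \<le> sum l X" "\<forall>v\<in>V. sum l (X \<inter> T v) \<le> m v" by blast
  define n where "n i = nat \<lfloor>l i\<rfloor>" for i
  have n: "real (n i) \<le> l i" "l i - 1 \<le> real (n i)" if "i \<in> X" for i using that l(1) by (auto simp: n_def)
  have "real s / \<rho> - card X \<le> (\<Sum>i\<in>X. l i - 1)" using l(2) by (simp add: sum_subtractf)
  also have "\<dots> \<le> (\<Sum>i\<in>X. real (n i))" using n by (intro sum_mono)
  finally have "real s / \<rho> - card X \<le> real (sum n X)" by simp
  moreover have "sum n (X \<inter> T v) \<le> m v" if "v \<in> V" for v
  proof -
    have "real (sum n (X \<inter> T v)) \<le> sum l (X \<inter> T v)" using n by (auto intro!: sum_mono)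
    also have "\<dots> \<le> m v" using l(3) that by blast
    finally show ?thesis unfolding of_nat_le_iff .
  qed
  ultimately show ?thesis by blast
qed

text \<open>
  Take \<open>a = \<lfloor>x\<rfloor>\<close>. The integer \<open>\<lceil>y\<rceil> + \<lceil>z\<rceil>\<close> is greater than \<open>r - \<lfloor>x\<rfloor> - 1\<close>, hence at least \<open>r - \<lfloor>x\<rfloor>\<close>; thus
  \<open>r - \<lfloor>x\<rfloor>\<close> can be split into roundings of \<open>y\<close> and \<open>z\<close>.
\<close>

lemma round_three_reals:
  fixes x y z :: real and r :: int
  assumes "x + y + z = of_int r"
  obtains a b c :: int where "a + b + c = r" "\<bar>of_int a - x\<bar> < 1" "\<bar>of_int b - y\<bar> < 1" "\<bar>of_int c - z\<bar> < 1"
proof -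
  define b where "b = min \<lceil>y\<rceil> (r - \<lfloor>x\<rfloor> - \<lfloor>z\<rfloor>)"
  have hi: "r - \<lfloor>x\<rfloor> \<le> \<lceil>y\<rceil> + \<lceil>z\<rceil>" using assms by linarith
  have lo: "\<lfloor>y\<rfloor> + \<lfloor>z\<rfloor> \<le> r - \<lfloor>x\<rfloor>" using assms by linarith
  show ?thesis
  proof (rule that[of "\<lfloor>x\<rfloor>" b "r - \<lfloor>x\<rfloor> - b"])
    have "\<lfloor>y\<rfloor> \<le> b" "b \<le> \<lceil>y\<rceil>" using lo by (auto simp: b_def)
    then show "\<bar>of_int b - y\<bar> < 1" by linarith
    have "\<lfloor>z\<rfloor> \<le> r - \<lfloor>x\<rfloor> - b" "r - \<lfloor>x\<rfloor> - b \<le> \<lceil>z\<rceil>" using hi by (auto simp: b_def min_def)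
    then show "\<bar>of_int (r - \<lfloor>x\<rfloor> - b) - z\<bar> < 1" by linarith
  qed linarith+
qed

text \<open>
  Scale \<open>N\<close> to a real packing \<open>x\<close> of size exactly \<open>r\<close> and round it to integers \<open>n\<close> with the same sum.
  For a set of at most one element, its sum grows by less than 1. For a set of two elements, the same
  holds since the sum over its complement drops by less than 1; the sum over all of \<open>X\<close> is kept. As the capacities are integers, they
  remain respected.
\<close>

lemma integral_packing_of_three:
  fixes N :: "'i \<Rightarrow> nat" and m :: "'v \<Rightarrow> nat"
  assumes X: "card X = 3" and t: "0 < t" and sum: "r * t \<le> sum N X"
    and N: "\<And>v. v \<in> V \<Longrightarrow> sum N (X \<inter> T v) \<le> m v * t"
  shows "\<exists>n :: 'i \<Rightarrow> nat. r \<le> sum n X \<and> (\<forall>v\<in>V. sum n (X \<inter> T v) \<le> m v)"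
proof (cases "r = 0")
  case True
  then show ?thesis by (intro exI[of _ "\<lambda>_. 0"]) auto
next
  case False
  define \<Sigma> where "\<Sigma> = sum N X"
  have "0 < r * t" using t False by simp
  then have \<Sigma>: "0 < \<Sigma>" using sum unfolding \<Sigma>_def by linarith
  obtain a b c where abc: "X = {a, b, c}" "a \<noteq> b" "a \<noteq> c" "b \<noteq> c"
    using X by (auto simp: card_3_iff)
  define x where "x i = real (N i) * real r / real \<Sigma>" for i
  have x0: "0 \<le> x i" for i by (simp add: x_def)
  have "sum x X = real (sum N X) * real r / real \<Sigma>"
    by (simp add: x_def sum_divide_distrib sum_distrib_right)
  then have "sum x X = r" using \<Sigma> unfolding \<Sigma>_def[symmetric] by simp
  then have "x a + x b + x c = of_int (int r)" using abc by simp
  then obtain na nb nc where n: "na + nb + nc = int r"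
    "\<bar>of_int na - x a\<bar> < 1" "\<bar>of_int nb - x b\<bar> < 1" "\<bar>of_int nc - x c\<bar> < 1" by (rule round_three_reals)
  define n where "n i = nat (if i = a then na else if i = b then nb else nc)" for i
  have nonneg: "0 \<le> na" "0 \<le> nb" "0 \<le> nc" using n(2-4) x0[of a] x0[of b] x0[of c] by linarith+
  then have n_abc: "int (n a) = na" "int (n b) = nb" "int (n c) = nc" using abc by (auto simp: n_def)
  have sum_n: "sum n X = r" using abc n(1) n_abc by simp
  have "sum n (X \<inter> T v) \<le> m v" if v: "v \<in> V" for v
  proof -
    have "finite X" using abc by simp
    then have part: "sum f (X \<inter> T v) = (if a \<in> T v then f a else 0) + (if b \<in> T v then f b else 0)
        + (if c \<in> T v then f c else 0)" for f :: "'i \<Rightarrow> real"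
      using abc by (simp add: sum.inter_restrict)
    have nx: "n a + n b + n c = r" "x a + x b + x c = real r" "\<bar>real (n a) - x a\<bar> < 1"
      "\<bar>real (n b) - x b\<bar> < 1" "\<bar>real (n c) - x c\<bar> < 1"
      using sum_n \<open>sum x X = r\<close> abc n(2-4) n_abc[symmetric] by auto
    have "real (sum n (X \<inter> T v)) = sum (\<lambda>i. real (n i)) (X \<inter> T v)" by simp
    also have "\<dots> < sum x (X \<inter> T v) + 1"
      unfolding part using nx by (cases "a \<in> T v"; cases "b \<in> T v"; cases "c \<in> T v"; simp; linarith)
    also have "sum x (X \<inter> T v) = real (sum N (X \<inter> T v)) * r / \<Sigma>"
      by (simp add: x_def sum_divide_distrib sum_distrib_right)
    also have "\<dots> \<le> real (m v)"
    proof -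
      have "sum N (X \<inter> T v) * r \<le> m v * t * r" using N[OF v] by (rule mult_right_mono) simp
      also have "\<dots> = m v * (r * t)" by simp
      also have "\<dots> \<le> m v * \<Sigma>" using sum unfolding \<Sigma>_def by (rule mult_left_mono) simp
      finally have "real (sum N (X \<inter> T v) * r) \<le> real (m v * \<Sigma>)" by (rule of_nat_mono)
      then show ?thesis using \<Sigma> by (simp add: field_simps)
    qed
    finally have "real (sum n (X \<inter> T v)) < real (m v + 1)" by simp
    then show ?thesis unfolding of_nat_less_iff by simp
  qed
  then show ?thesis using sum_n by (intro exI[of _ n]) auto
qed

section \<open>Ideals spanned by monomials\<close>

abbreviation exponents_in :: "'v set \<Rightarrow> ('v \<Rightarrow>\<^sub>0 nat) \<Rightarrow> bool" where
  "exponents_in V m \<equiv> Poly_Mapping.keys m \<subseteq> V"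

definition monomial_span ::
    "'v set \<Rightarrow> (('v \<Rightarrow>\<^sub>0 nat) \<Rightarrow> bool) \<Rightarrow> (('v \<Rightarrow>\<^sub>0 nat) \<Rightarrow>\<^sub>0 'k::field) set" where
  "monomial_span V Q = {p. \<forall>m\<in>Poly_Mapping.keys p. exponents_in V m \<and> Q m}"

abbreviation monomial :: "('v \<Rightarrow>\<^sub>0 nat) \<Rightarrow> (('v \<Rightarrow>\<^sub>0 nat) \<Rightarrow>\<^sub>0 'k::field)" where
  "monomial m \<equiv> Poly_Mapping.single m 1"

lemma poly_ring_simps [simp]:
  "carrier (poly_ring V) = monomial_span V (\<lambda>_. True)"
  "mult (poly_ring V) = (*)" "one (poly_ring V) = 1" "zero (poly_ring V) = 0" "add (poly_ring V) = (+)"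
  by (simp_all add: poly_ring_def monomial_span_def)

lemma poly_ring_ring: "ring (poly_ring V)"
  using poly_ring_cring by (rule cring.axioms)

lemma poly_ring_a_inv:
  assumes "p \<in> carrier (poly_ring V)"
  shows "\<ominus>\<^bsub>poly_ring V\<^esub> p = - p"
proof -
  interpret ring "poly_ring V" by (rule poly_ring_ring)
  have "- p \<in> carrier (poly_ring V)" using assms by (auto simp: monomial_span_def in_keys_iff)
  then show ?thesis using assms by (intro minus_equality) auto
qed

lemma poly_mapping_eq_sum_single:
  "p = (\<Sum>m\<in>Poly_Mapping.keys p. Poly_Mapping.single m (Poly_Mapping.lookup p m))"
  by (rule poly_mapping_eqI)
    (auto simp: lookup_sum lookup_single when_def in_keys_iff)

lemma ideal_monomial_span:
  assumes up: "\<And>m n. Q m \<Longrightarrow> Q (m + n)"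
  shows "ideal (monomial_span V Q :: (('v \<Rightarrow>\<^sub>0 nat) \<Rightarrow>\<^sub>0 'k::field) set) (poly_ring V)"
proof -
  let ?R = "poly_ring V :: (('v \<Rightarrow>\<^sub>0 nat) \<Rightarrow>\<^sub>0 'k) ring"
  let ?J = "monomial_span V Q :: (('v \<Rightarrow>\<^sub>0 nat) \<Rightarrow>\<^sub>0 'k) set"
  interpret cring ?R by (rule poly_ring_cring)
  have mult: "p * x \<in> ?J" if "p \<in> ?J" "x \<in> carrier ?R" for p x
  proof -
    have "exponents_in V m \<and> Q m" if m: "m \<in> Poly_Mapping.keys (p * x)" for m
    proof -
      obtain a b where ab: "m = a + b" "a \<in> Poly_Mapping.keys p" "b \<in> Poly_Mapping.keys x"
        using m keys_mult[of p x] by blast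
      then have "exponents_in V a" "Q a" "exponents_in V b"
        using \<open>p \<in> ?J\<close> \<open>x \<in> carrier ?R\<close> by (auto simp: monomial_span_def)
      then show ?thesis using up ab(1) Poly_Mapping.keys_add[of a b] by auto
    qed
    then show ?thesis by (simp add: monomial_span_def)
  qed
  show ?thesis
  proof (rule idealI)
    show "subgroup ?J (add_monoid ?R)"
    proof (unfold_locales)
      show "?J \<subseteq> carrier (add_monoid ?R)" by (auto simp: monomial_span_def)
      show "x \<otimes>\<^bsub>add_monoid ?R\<^esub> y \<in> ?J" if "x \<in> ?J" "y \<in> ?J" for x y
        using that Poly_Mapping.keys_add[of x y] by (auto simp: monomial_span_def)
      show "\<one>\<^bsub>add_monoid ?R\<^esub> \<in> ?J" by (simp add: monomial_span_def)
      show "inv\<^bsub>add_monoid ?R\<^esub> x \<in> ?J" if "x \<in> ?J" for x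
      proof -
        have "x \<in> carrier ?R" using that by (auto simp: monomial_span_def)
        then have "\<ominus>\<^bsub>?R\<^esub> x = - x" by (rule poly_ring_a_inv)
        then show ?thesis using that by (simp add: a_inv_def monomial_span_def in_keys_iff)
      qed
    qed
    fix a x assume "a \<in> ?J" "x \<in> carrier ?R"
    from mult[OF this] show "a \<otimes>\<^bsub>?R\<^esub> x \<in> ?J" "x \<otimes>\<^bsub>?R\<^esub> a \<in> ?J"
      by (simp_all add: mult.commute)
  qed (rule ring_axioms)
qed

lemma ideal_sum_closed:
  assumes "ideal J (poly_ring V)" "finite A" "\<And>x. x \<in> A \<Longrightarrow> f x \<in> J"
  shows "sum f A \<in> J"
  using assms(2,3)
proof (induction A rule: finite_induct)
  case empty
  then show ?case using additive_subgroup.zero_closed[OF ideal.axioms(1)[OF assms(1)]] by simp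
next
  case (insert x A)
  then show ?case using additive_subgroup.a_closed[OF ideal.axioms(1)[OF assms(1)], of "f x" "sum f A"] by simp
qed

lemma monomial_span_subset_ideal:
  fixes J :: "(('v \<Rightarrow>\<^sub>0 nat) \<Rightarrow>\<^sub>0 'k::field) set"
  assumes J: "ideal J (poly_ring V)" and "\<And>m. exponents_in V m \<Longrightarrow> Q m \<Longrightarrow> monomial m \<in> J"
  shows "monomial_span V Q \<subseteq> J"
proof
  fix p :: "('v \<Rightarrow>\<^sub>0 nat) \<Rightarrow>\<^sub>0 'k" assume p: "p \<in> monomial_span V Q"
  have "Poly_Mapping.single m c \<in> J" if "m \<in> Poly_Mapping.keys p" for m and c :: 'k
  proof -
    have "monomial m \<in> J" using assms(2) that p by (auto simp: monomial_span_def)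
    moreover have "Poly_Mapping.single 0 c \<in> carrier (poly_ring V :: (('v \<Rightarrow>\<^sub>0 nat) \<Rightarrow>\<^sub>0 'k) ring)" by (simp add: monomial_span_def)
    ultimately have "Poly_Mapping.single 0 c * monomial m \<in> J" using ideal.I_l_closed[OF J] by fastforce
    then show ?thesis by (simp add: mult_single)
  qed
  then show "p \<in> J" by (subst poly_mapping_eq_sum_single) (intro ideal_sum_closed[OF J], auto)
qed

lemma monomial_span_subset_iff:
  "(monomial_span V P :: (('v \<Rightarrow>\<^sub>0 nat) \<Rightarrow>\<^sub>0 'k::field) set) \<subseteq> monomial_span V Q \<longleftrightarrow>
     (\<forall>m. exponents_in V m \<longrightarrow> P m \<longrightarrow> Q m)"
proof
  assume sub: "(monomial_span V P :: (('v \<Rightarrow>\<^sub>0 nat) \<Rightarrow>\<^sub>0 'k) set) \<subseteq> monomial_span V Q"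
  show "\<forall>m. exponents_in V m \<longrightarrow> P m \<longrightarrow> Q m"
  proof (intro allI impI)
    fix m :: "'v \<Rightarrow>\<^sub>0 nat" assume "exponents_in V m" "P m"
    then have "(monomial m :: ('v \<Rightarrow>\<^sub>0 nat) \<Rightarrow>\<^sub>0 'k) \<in> monomial_span V P" by (simp add: monomial_span_def)
    then have "(monomial m :: ('v \<Rightarrow>\<^sub>0 nat) \<Rightarrow>\<^sub>0 'k) \<in> monomial_span V Q" using sub by (rule rev_subsetD)
    then show "Q m" by (simp add: monomial_span_def)
  qed
qed (auto simp: monomial_span_def)

lemma ideal_power_0: "ideal_power R J 0 = carrier R"
  by (simp add: nat_pow_def ideals_set_def)

lemma ideal_power_Suc: "ideal_power R J (Suc n) = ideal_prod R (ideal_power R J n) J"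
  by (simp add: nat_pow_def ideals_set_def)

lemma ideal_ideal_power:
  assumes "ring R" "ideal J R"
  shows "ideal (ideal_power R J n) R"
proof (induction n)
  case 0
  then show ?case using ring.oneideal[OF assms(1)] by (simp only: ideal_power_0)
next
  case (Suc n)
  then show ?case using ring.ideal_prod_is_ideal[OF assms(1) Suc assms(2)] by (simp only: ideal_power_Suc)
qed

lemma ideal_power_monomial_span_subset:
  fixes Q :: "('v \<Rightarrow>\<^sub>0 nat) \<Rightarrow> bool" and P :: "nat \<Rightarrow> ('v \<Rightarrow>\<^sub>0 nat) \<Rightarrow> bool"
  assumes "\<And>m. P 0 m" "\<And>n a b. P n a \<Longrightarrow> Q b \<Longrightarrow> P (Suc n) (a + b)"
  shows "ideal_power (poly_ring V) (monomial_span V Q) n \<subseteq> (monomial_span V (P n) :: (('v \<Rightarrow>\<^sub>0 nat) \<Rightarrow>\<^sub>0 'k::field) set)"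
proof (induction n)
  case 0
  show ?case unfolding ideal_power_0 using assms(1) by (auto simp: monomial_span_def)
next
  case (Suc n)
  show ?case
  proof
    fix p :: "('v \<Rightarrow>\<^sub>0 nat) \<Rightarrow>\<^sub>0 'k"
    assume "p \<in> ideal_power (poly_ring V) (monomial_span V Q) (Suc n)"
    then have "p \<in> ideal_prod (poly_ring V) (ideal_power (poly_ring V) (monomial_span V Q) n) (monomial_span V Q)"
      by (simp only: ideal_power_Suc)
    then show "p \<in> monomial_span V (P (Suc n))"
    proof (induction rule: ideal_prod.induct)
      case (prod i j)
      then have i: "i \<in> monomial_span V (P n)" using Suc by blast
      have "exponents_in V m \<and> P (Suc n) m" if m: "m \<in> Poly_Mapping.keys (i * j)" for m
      proof -
        obtain a b where ab: "m = a + b" "a \<in> Poly_Mapping.keys i" "b \<in> Poly_Mapping.keys j"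
          using m keys_mult[of i j] by blast
        have "exponents_in V a \<and> P n a" "exponents_in V b \<and> Q b"
          using ab i prod.hyps(2) by (auto simp: monomial_span_def)
        then show ?thesis using assms(2) Poly_Mapping.keys_add[of a b] unfolding ab(1) by blast
      qed
      then show ?case by (simp add: monomial_span_def)
    next
      case (sum s1 s2)
      then show ?case using Poly_Mapping.keys_add[of s1 s2] by (auto simp: monomial_span_def)
    qed
  qed
qed

lemma monomial_mult_in_ideal:
  fixes J :: "(('v \<Rightarrow>\<^sub>0 nat) \<Rightarrow>\<^sub>0 'k::field) set"
  assumes "ideal J (poly_ring V)" "monomial a \<in> J" "exponents_in V b"
  shows "monomial (a + b) \<in> J"
proof -
  have "monomial b \<in> carrier (poly_ring V :: (('v \<Rightarrow>\<^sub>0 nat) \<Rightarrow>\<^sub>0 'k) ring)" using assms(3) by (simp add: monomial_span_def)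
  then have "monomial a * monomial b \<in> J" using ideal.I_r_closed[OF assms(1,2)] by fastforce
  then show ?thesis by (simp add: mult_single)
qed

text \<open>
  Among the exponent vectors in \<open>A\<close> and in \<open>B\<close> keep those with maximal exponent of one variable, and
  recurse on the other variables. A sum of two kept vectors can only arise from kept vectors.
\<close>

lemma unique_sum_of_exponents:
  fixes A B :: "('v \<Rightarrow>\<^sub>0 nat) set"
  assumes "finite W" "finite A" "A \<noteq> {}" "finite B" "B \<noteq> {}"
    and "\<And>a a' v. a \<in> A \<Longrightarrow> a' \<in> A \<Longrightarrow> v \<notin> W \<Longrightarrow> Poly_Mapping.lookup a v = Poly_Mapping.lookup a' v"
    and "\<And>b b' v. b \<in> B \<Longrightarrow> b' \<in> B \<Longrightarrow> v \<notin> W \<Longrightarrow> Poly_Mapping.lookup b v = Poly_Mapping.lookup b' v"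
  shows "\<exists>a\<in>A. \<exists>b\<in>B. \<forall>a'\<in>A. \<forall>b'\<in>B. a' + b' = a + b \<longrightarrow> a' = a \<and> b' = b"
  using assms
proof (induction W arbitrary: A B rule: finite_induct)
  case empty
  then show ?case by (metis all_not_in_conv empty_iff poly_mapping_eqI)
next
  case (insert v W)
  let ?l = "\<lambda>a. Poly_Mapping.lookup a v"
  define MA where "MA = Max (?l ` A)"
  define MB where "MB = Max (?l ` B)"
  have MA: "?l a \<le> MA" if "a \<in> A" for a using that insert.prems by (simp add: MA_def)
  have MB: "?l b \<le> MB" if "b \<in> B" for b using that insert.prems by (simp add: MB_def)
  define A' where "A' = {a \<in> A. ?l a = MA}"
  define B' where "B' = {b \<in> B. ?l b = MB}"
  have "MA \<in> ?l ` A" "MB \<in> ?l ` B" unfolding MA_def MB_def using insert.prems by (auto intro!: Max_in)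
  then have ne: "A' \<noteq> {}" "B' \<noteq> {}" by (auto simp: A'_def B'_def)
  have fin: "finite A'" "finite B'" using insert.prems by (auto simp: A'_def B'_def)
  have agreeA: "Poly_Mapping.lookup a u = Poly_Mapping.lookup a' u" if "a \<in> A'" "a' \<in> A'" "u \<notin> W" for a a' u
    using that insert.prems(5)[of a a' u] by (cases "u = v") (auto simp: A'_def)
  have agreeB: "Poly_Mapping.lookup b u = Poly_Mapping.lookup b' u" if "b \<in> B'" "b' \<in> B'" "u \<notin> W" for b b' u
    using that insert.prems(6)[of b b' u] by (cases "u = v") (auto simp: B'_def)
  from insert.IH[OF fin(1) ne(1) fin(2) ne(2) agreeA agreeB] obtain a b where
    ab: "a \<in> A'" "b \<in> B'" and uniq: "\<And>a' b'. a' \<in> A' \<Longrightarrow> b' \<in> B' \<Longrightarrow> a' + b' = a + b \<Longrightarrow> a' = a \<and> b' = b"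
    by blast
  have "a' = a \<and> b' = b" if "a' \<in> A" "b' \<in> B" "a' + b' = a + b" for a' b'
  proof -
    have "?l a' + ?l b' = ?l a + ?l b" using that(3) by (metis lookup_add)
    then have "?l a' = MA" "?l b' = MB" using ab MA[OF that(1)] MB[OF that(2)] by (auto simp: A'_def B'_def)
    then show ?thesis using that uniq by (auto simp: A'_def B'_def)
  qed
  moreover have "a \<in> A" "b \<in> B" using ab by (auto simp: A'_def B'_def)
  ultimately show ?case by blast
qed

lemma lookup_mult_keys:
  "Poly_Mapping.lookup (p * q) m = (\<Sum>a\<in>Poly_Mapping.keys p. \<Sum>b\<in>Poly_Mapping.keys q.
     if a + b = m then Poly_Mapping.lookup p a * Poly_Mapping.lookup q b else 0)"
proof -
  have "p * q = (\<Sum>a\<in>Poly_Mapping.keys p. Poly_Mapping.single a (Poly_Mapping.lookup p a)) *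
      (\<Sum>b\<in>Poly_Mapping.keys q. Poly_Mapping.single b (Poly_Mapping.lookup q b))"
    by (simp flip: poly_mapping_eq_sum_single)
  then show ?thesis
    by (simp add: sum_product mult_single lookup_sum lookup_single when_def)
qed

text \<open>
  If neither factor lies in the ideal, both have monomials free of the variables in \<open>C\<close>. Among these
  choose a pair whose product arises only once: its coefficient in the product is nonzero.
\<close>

lemma primeideal_monomial_span_variables:
  assumes "finite V" "C \<subseteq> V"
  shows "primeideal (monomial_span V (\<lambda>m. \<exists>v\<in>C. 0 < Poly_Mapping.lookup m v) ::
    (('v \<Rightarrow>\<^sub>0 nat) \<Rightarrow>\<^sub>0 'k::field) set) (poly_ring V)"
proof (rule primeidealI)
  let ?R = "poly_ring V :: (('v \<Rightarrow>\<^sub>0 nat) \<Rightarrow>\<^sub>0 'k) ring"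
  let ?Q = "\<lambda>m. \<exists>v\<in>C. 0 < Poly_Mapping.lookup m v"
  let ?P = "monomial_span V ?Q :: (('v \<Rightarrow>\<^sub>0 nat) \<Rightarrow>\<^sub>0 'k) set"
  show "ideal ?P ?R" by (rule ideal_monomial_span) (auto simp: lookup_add)
  show "cring ?R" by (rule poly_ring_cring)
  have "1 \<in> carrier ?R" "1 \<notin> ?P" by (auto simp: monomial_span_def)
  then show "carrier ?R \<noteq> ?P" by blast
  fix p q assume pq: "p \<in> carrier ?R" "q \<in> carrier ?R" and prod: "p \<otimes>\<^bsub>?R\<^esub> q \<in> ?P"
  show "p \<in> ?P \<or> q \<in> ?P"
  proof (rule ccontr)
    assume not: "\<not> ?thesis"
    define A where "A = {m \<in> Poly_Mapping.keys p. \<not> ?Q m}"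
    define B where "B = {m \<in> Poly_Mapping.keys q. \<not> ?Q m}"
    have AB: "finite A" "finite B" "A \<noteq> {}" "B \<noteq> {}" using not pq by (auto simp: A_def B_def monomial_span_def)
    have expo: "exponents_in V m" if "m \<in> A \<union> B" for m using that pq by (auto simp: A_def B_def monomial_span_def)
    have zero: "Poly_Mapping.lookup m v = 0" if "m \<in> A \<union> B" "v \<notin> V" for m v
      using expo[OF that(1)] that(2) by (auto simp: in_keys_iff)
    have "\<exists>a\<in>A. \<exists>b\<in>B. \<forall>a'\<in>A. \<forall>b'\<in>B. a' + b' = a + b \<longrightarrow> a' = a \<and> b' = b"
      by (rule unique_sum_of_exponents[OF assms(1) AB(1,3,2,4)]) (simp_all add: zero)
    then obtain a b where ab: "a \<in> A" "b \<in> B"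
      and uniq: "\<And>a' b'. a' \<in> A \<Longrightarrow> b' \<in> B \<Longrightarrow> a' + b' = a + b \<Longrightarrow> a' = a \<and> b' = b"
      by blast
    have "Poly_Mapping.lookup (p * q) (a + b) = (\<Sum>a'\<in>Poly_Mapping.keys p. \<Sum>b'\<in>Poly_Mapping.keys q.
       if a' = a \<and> b' = b then Poly_Mapping.lookup p a * Poly_Mapping.lookup q b else 0)"
      unfolding lookup_mult_keys
    proof (intro sum.cong refl)
      fix a' b' assume keys: "a' \<in> Poly_Mapping.keys p" "b' \<in> Poly_Mapping.keys q"
      have "a' = a \<and> b' = b" if eq: "a' + b' = a + b"
      proof (rule uniq)
        have nQ: "\<not> ?Q (a + b)" using ab by (auto simp: A_def B_def lookup_add)
        have nQ': "\<not> ?Q (a' + b')" using nQ unfolding eq .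
        then show "a' \<in> A" "b' \<in> B" using keys by (auto simp: A_def B_def lookup_add)
      qed (rule eq)
      then show "(if a' + b' = a + b then Poly_Mapping.lookup p a' * Poly_Mapping.lookup q b' else 0) =
          (if a' = a \<and> b' = b then Poly_Mapping.lookup p a * Poly_Mapping.lookup q b else 0)" by auto
    qed
    also have "\<dots> = (\<Sum>a'\<in>Poly_Mapping.keys p. if a' = a then
        (\<Sum>b'\<in>Poly_Mapping.keys q. if b' = b then Poly_Mapping.lookup p a * Poly_Mapping.lookup q b else 0) else 0)"
      by (intro sum.cong) auto
    also have "\<dots> = Poly_Mapping.lookup p a * Poly_Mapping.lookup q b"
      using ab by (simp add: A_def B_def)
    also have "\<dots> \<noteq> 0" using ab by (auto simp: A_def B_def in_keys_iff)
    finally have "a + b \<in> Poly_Mapping.keys (p * q)" by (simp add: in_keys_iff)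
    then have "?Q (a + b)" using prod by (auto simp: monomial_span_def)
    then show False using ab by (auto simp: A_def B_def lookup_add)
  qed
qed

section \<open>Powers and symbolic powers of square-free monomial ideals\<close>

definition squarefree_exponent :: "'v set \<Rightarrow> ('v \<Rightarrow>\<^sub>0 nat)" where
  "squarefree_exponent A = (\<Sum>v\<in>A. Poly_Mapping.single v 1)"

lemma lookup_squarefree_exponent:
  "finite A \<Longrightarrow> Poly_Mapping.lookup (squarefree_exponent A) v = of_bool (v \<in> A)"
  by (simp add: squarefree_exponent_def lookup_sum lookup_single when_def)

lemma keys_squarefree_exponent: "finite A \<Longrightarrow> Poly_Mapping.keys (squarefree_exponent A) = A"
  by (auto simp: in_keys_iff lookup_squarefree_exponent)

lemma prod_pvar_eq_monomial:
  "finite A \<Longrightarrow> (\<Prod>v\<in>A. pvar v) = monomial (squarefree_exponent A)"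
  by (induction A rule: finite_induct) (simp_all add: squarefree_exponent_def pvar_def mult_single)

lemma monomial_in_ideal_power:
  fixes J :: "(('v \<Rightarrow>\<^sub>0 nat) \<Rightarrow>\<^sub>0 'k::field) set"
  assumes J: "ideal J (poly_ring V)" and C: "finite C" "\<And>v. v \<in> C \<Longrightarrow> pvar v \<in> J"
  shows "exponents_in V m \<Longrightarrow> s \<le> (\<Sum>v\<in>C. Poly_Mapping.lookup m v) \<Longrightarrow> monomial m \<in> ideal_power (poly_ring V) J s"
proof (induction s arbitrary: m)
  case 0
  then show ?case unfolding ideal_power_0 by (simp add: monomial_span_def)
next
  case (Suc s)
  have "(\<Sum>v\<in>C. Poly_Mapping.lookup m v) \<noteq> 0" using Suc.prems by simp
  then obtain v where v: "v \<in> C" "Poly_Mapping.lookup m v \<noteq> 0" by (meson sum.neutral)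
  define m' where "m' = m - Poly_Mapping.single v 1"
  have look: "Poly_Mapping.lookup m u = Poly_Mapping.lookup m' u + of_bool (u = v)" for u
    using v by (cases "u = v") (auto simp: m'_def lookup_minus lookup_single)
  then have m: "m = m' + Poly_Mapping.single v 1"
    by (intro poly_mapping_eqI) (auto simp: lookup_add lookup_single when_def)
  have "Suc s \<le> (\<Sum>u\<in>C. Poly_Mapping.lookup m' u) + (\<Sum>u\<in>C. of_bool (u = v))"
    using Suc.prems(2) by (simp add: look sum.distrib)
  then have "s \<le> (\<Sum>u\<in>C. Poly_Mapping.lookup m' u)" using v C by (simp add: of_bool_def)
  moreover have "exponents_in V m'" using Suc.prems(1) look by (auto simp: in_keys_iff subset_iff)
  ultimately have "monomial m' \<in> ideal_power (poly_ring V) J s" by (intro Suc.IH)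
  from ideal_prod.prod[OF this C(2)[OF v(1)], where R = "poly_ring V"]
  show ?case unfolding ideal_power_Suc by (simp add: m pvar_def mult_single)
qed

lemma primeideal_contains_variable:
  fixes P :: "(('v \<Rightarrow>\<^sub>0 nat) \<Rightarrow>\<^sub>0 'k::field) set"
  assumes P: "primeideal P (poly_ring V)" and "finite A" "A \<subseteq> V" "(\<Prod>v\<in>A. pvar v) \<in> P"
  shows "\<exists>v\<in>A. pvar v \<in> P"
  using assms(2-4)
proof (induction A rule: finite_induct)
  case empty
  interpret P: primeideal P "poly_ring V" by (rule P)
  have "P = carrier (poly_ring V)" using P.one_imp_carrier empty by simp
  then show ?case using P.I_notcarr by blast
next
  case (insert v A)
  interpret P: primeideal P "poly_ring V" by (rule P)
  have "pvar v \<in> carrier (poly_ring V :: (('v \<Rightarrow>\<^sub>0 nat) \<Rightarrow>\<^sub>0 'k) ring)"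
    using insert.prems by (simp add: pvar_def monomial_span_def)
  moreover have "(\<Prod>v\<in>A. pvar v) \<in> carrier (poly_ring V :: (('v \<Rightarrow>\<^sub>0 nat) \<Rightarrow>\<^sub>0 'k) ring)"
    using insert by (simp add: prod_pvar_eq_monomial monomial_span_def keys_squarefree_exponent)
  moreover have "pvar v \<otimes>\<^bsub>poly_ring V\<^esub> (\<Prod>v\<in>A. pvar v) \<in> P" using insert by simp
  ultimately have "pvar v \<in> P \<or> (\<Prod>v\<in>A. pvar v) \<in> P" by (rule P.I_prime)
  then show ?case using insert by auto
qed

lemma in_symbolic_power_iff:
  "p \<in> symbolic_power R J s \<longleftrightarrow> p \<in> carrier R \<and> (\<forall>P\<in>minimal_primes R J. p \<in> ideal_power R P s)"
  by (auto simp: symbolic_power_def)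

lemma sum_increment:
  fixes n n' :: "nat \<Rightarrow> nat"
  assumes "finite B" "\<And>j. n' j = n j + of_bool (j = i)"
  shows "sum n' B = sum n B + of_bool (i \<in> B)"
  using assms(1) by (simp add: assms(2) sum.distrib of_bool_def)

text \<open>
  The generators are given by their supports, as a family rather than a set: the index set \<open>{1..q}\<close> is
  the ground set of the set cover problem.
\<close>

locale squarefree_generators =
  fixes V :: "'v set" and A :: "nat \<Rightarrow> 'v set" and q :: nat
  assumes finite_V: "finite V"
    and A_subset: "\<And>i. i \<in> {1..q} \<Longrightarrow> A i \<subseteq> V"
    and A_nonempty: "\<And>i. i \<in> {1..q} \<Longrightarrow> A i \<noteq> {}"
begin

definition generated_ideal :: "(('v \<Rightarrow>\<^sub>0 nat) \<Rightarrow>\<^sub>0 'k::field) set" where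
  "generated_ideal = Idl\<^bsub>poly_ring V\<^esub> ((\<lambda>i. \<Prod>v\<in>A i. pvar v) ` {1..q})"

definition divisible_gens :: "'v \<Rightarrow> nat set" where
  "divisible_gens v = {i. v \<in> A i}"

definition covers_ge :: "nat \<Rightarrow> ('v \<Rightarrow>\<^sub>0 nat) \<Rightarrow> bool" where
  "covers_ge s m \<longleftrightarrow> (\<forall>C\<subseteq>V. {1..q} \<subseteq> (\<Union>v\<in>C. divisible_gens v) \<longrightarrow> s \<le> (\<Sum>v\<in>C. Poly_Mapping.lookup m v))"

definition packs :: "nat \<Rightarrow> ('v \<Rightarrow>\<^sub>0 nat) \<Rightarrow> bool" where
  "packs r m \<longleftrightarrow> (\<exists>n. r \<le> sum n {1..q} \<and> (\<forall>v\<in>V. sum n ({1..q} \<inter> divisible_gens v) \<le> Poly_Mapping.lookup m v))"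

lemma finite_A: "i \<in> {1..q} \<Longrightarrow> finite (A i)"
  using A_subset finite_V finite_subset by blast

lemma generator_eq_monomial:
  "i \<in> {1..q} \<Longrightarrow> (\<Prod>v\<in>A i. pvar v) = monomial (squarefree_exponent (A i))"
  by (rule prod_pvar_eq_monomial[OF finite_A])

lemma generator_in_span:
  assumes "i \<in> {1..q}" "Q (squarefree_exponent (A i))"
  shows "(\<Prod>v\<in>A i. pvar v) \<in> monomial_span V Q"
  unfolding generator_eq_monomial[OF assms(1)] using assms A_subset[OF assms(1)]
  by (simp add: monomial_span_def keys_squarefree_exponent finite_A)

lemma generators_subset_carrier:
  "(\<lambda>i. \<Prod>v\<in>A i. pvar v) ` {1..q} \<subseteq> carrier (poly_ring V)"
  unfolding poly_ring_simps by (intro image_subsetI generator_in_span) auto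

lemma ideal_generated_ideal: "ideal generated_ideal (poly_ring V)"
  unfolding generated_ideal_def
  by (rule ring.genideal_ideal[OF poly_ring_ring generators_subset_carrier])

lemma generator_in_generated_ideal:
  "i \<in> {1..q} \<Longrightarrow> (\<Prod>v\<in>A i. pvar v) \<in> generated_ideal"
  unfolding generated_ideal_def
  using ring.genideal_self[OF poly_ring_ring generators_subset_carrier] by blast

lemma generated_ideal_eq:
  "generated_ideal = monomial_span V (\<lambda>m. \<exists>i\<in>{1..q}. \<forall>v\<in>A i. 0 < Poly_Mapping.lookup m v)"
    (is "_ = monomial_span V ?Q")
proof
  show "generated_ideal \<subseteq> monomial_span V ?Q"
    unfolding generated_ideal_def
  proof (rule ring.genideal_minimal[OF poly_ring_ring])
    show "ideal (monomial_span V ?Q) (poly_ring V)"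
      by (rule ideal_monomial_span) (auto simp: lookup_add)
    show "(\<lambda>i. \<Prod>v\<in>A i. pvar v) ` {1..q} \<subseteq> monomial_span V ?Q"
    proof (intro image_subsetI generator_in_span)
      fix i assume i: "i \<in> {1..q}"
      then show "\<exists>j\<in>{1..q}. \<forall>v\<in>A j. 0 < Poly_Mapping.lookup (squarefree_exponent (A i)) v"
        by (intro bexI[of _ i]) (auto simp: lookup_squarefree_exponent[OF finite_A[OF i]])
    qed
  qed
  show "monomial_span V ?Q \<subseteq> generated_ideal"
  proof (rule monomial_span_subset_ideal[OF ideal_generated_ideal])
    fix m assume m: "exponents_in V m" "?Q m"
    then obtain i where i: "i \<in> {1..q}" "\<And>v. v \<in> A i \<Longrightarrow> 0 < Poly_Mapping.lookup m v" by blast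
    have eq: "m = squarefree_exponent (A i) + (m - squarefree_exponent (A i))"
      using i(2) by (intro poly_mapping_eqI)
        (auto simp: lookup_add lookup_minus lookup_squarefree_exponent finite_A[OF i(1)] of_bool_def)
    have "monomial (squarefree_exponent (A i)) \<in> generated_ideal"
      using generator_in_generated_ideal[OF i(1)] by (simp add: prod_pvar_eq_monomial finite_A[OF i(1)])
    moreover have "exponents_in V (m - squarefree_exponent (A i))"
      using m(1) by (auto simp: in_keys_iff lookup_minus subset_iff)
    ultimately show "monomial m \<in> generated_ideal"
      by (subst eq) (rule monomial_mult_in_ideal[OF ideal_generated_ideal])
  qed
qed

text \<open>
  A product of \<open>r\<close> generators is recorded by the multiplicities \<open>n i\<close> of its factors; it divides the
  monomial \<open>m\<close> iff these multiplicities pack into \<open>m\<close>.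
\<close>

lemma ideal_power_eq:
  "ideal_power (poly_ring V) (generated_ideal :: (('v \<Rightarrow>\<^sub>0 nat) \<Rightarrow>\<^sub>0 'k::field) set) r = monomial_span V (packs r)"
proof
  let ?I = "generated_ideal :: (('v \<Rightarrow>\<^sub>0 nat) \<Rightarrow>\<^sub>0 'k) set"
  show "ideal_power (poly_ring V) ?I r \<subseteq> monomial_span V (packs r)"
    unfolding generated_ideal_eq
  proof (rule ideal_power_monomial_span_subset)
    show "packs 0 m" for m by (auto simp: packs_def intro: exI[of _ "\<lambda>_. 0"])
  next
    fix r and a b :: "'v \<Rightarrow>\<^sub>0 nat" assume "packs r a" and "\<exists>i\<in>{1..q}. \<forall>v\<in>A i. 0 < Poly_Mapping.lookup b v"
    then obtain n i where n: "r \<le> sum n {1..q}" "\<forall>v\<in>V. sum n ({1..q} \<inter> divisible_gens v) \<le> Poly_Mapping.lookup a v"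
      and i: "i \<in> {1..q}" "\<forall>v\<in>A i. 0 < Poly_Mapping.lookup b v" unfolding packs_def by blast
    define n' where "n' j = n j + of_bool (j = i)" for j
    have sums: "finite B \<Longrightarrow> sum n' B = sum n B + of_bool (i \<in> B)" for B
      by (rule sum_increment) (simp_all add: n'_def)
    have "Suc r \<le> sum n' {1..q}" using n(1) i(1) by (simp add: sums)
    moreover have "sum n' ({1..q} \<inter> divisible_gens v) \<le> Poly_Mapping.lookup (a + b) v" if v: "v \<in> V" for v
    proof -
      have "of_bool (i \<in> {1..q} \<inter> divisible_gens v) \<le> Poly_Mapping.lookup b v" using i by (auto simp: divisible_gens_def Suc_le_eq)
      moreover have "sum n ({1..q} \<inter> divisible_gens v) \<le> Poly_Mapping.lookup a v" using n(2) v by blast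
      moreover have "sum n' ({1..q} \<inter> divisible_gens v) = sum n ({1..q} \<inter> divisible_gens v) + of_bool (i \<in> {1..q} \<inter> divisible_gens v)"
        by (rule sums) simp
      ultimately show ?thesis by (simp only: lookup_add)
    qed
    ultimately show "packs (Suc r) (a + b)" unfolding packs_def by blast
  qed
  have "monomial m \<in> ideal_power (poly_ring V) ?I r" if "exponents_in V m" "packs r m" for m
    using that
  proof (induction r arbitrary: m)
    case 0
    then show ?case unfolding ideal_power_0 by (simp add: monomial_span_def)
  next
    case (Suc r)
    then obtain n where n: "Suc r \<le> sum n {1..q}"
      "\<And>v. v \<in> V \<Longrightarrow> sum n ({1..q} \<inter> divisible_gens v) \<le> Poly_Mapping.lookup m v" unfolding packs_def by blast
    have "sum n {1..q} \<noteq> 0" using n(1) by linarith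
    then obtain i where i: "i \<in> {1..q}" "n i \<noteq> 0" by (meson sum.neutral)
    define n' where "n' j = n j - of_bool (j = i)" for j
    have sums: "finite B \<Longrightarrow> sum n B = sum n' B + of_bool (i \<in> B)" for B
      by (rule sum_increment) (use i in \<open>auto simp: n'_def\<close>)
    define m' where "m' = m - squarefree_exponent (A i)"
    have pos: "0 < Poly_Mapping.lookup m v" if "v \<in> A i" for v
    proof -
      have "n i \<le> sum n ({1..q} \<inter> divisible_gens v)" using i(1) that by (intro member_le_sum) (auto simp: divisible_gens_def)
      then show ?thesis using n(2)[of v] i A_subset that by fastforce
    qed
    have look: "Poly_Mapping.lookup m v = Poly_Mapping.lookup m' v + of_bool (v \<in> A i)" for v
      using pos by (auto simp: m'_def lookup_minus lookup_squarefree_exponent finite_A[OF i(1)])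
    then have m: "m = m' + squarefree_exponent (A i)"
      by (intro poly_mapping_eqI) (simp add: lookup_add lookup_squarefree_exponent finite_A[OF i(1)])
    have "exponents_in V m'" using Suc.prems(1) look by (auto simp: in_keys_iff subset_iff)
    moreover have "packs r m'"
      unfolding packs_def
    proof (intro exI[of _ n'] conjI ballI)
      show "r \<le> sum n' {1..q}" using n(1) i(1) by (simp add: sums)
      fix v assume v: "v \<in> V"
      show "sum n' ({1..q} \<inter> divisible_gens v) \<le> Poly_Mapping.lookup m' v"
        using n(2)[OF v] i(1) look[of v] sums[of "{1..q} \<inter> divisible_gens v"] by (auto simp: divisible_gens_def of_bool_def split: if_splits)
    qed
    ultimately have "monomial m' \<in> ideal_power (poly_ring V) ?I r" by (intro Suc.IH)
    from ideal_prod.prod[OF this generator_in_generated_ideal[OF i(1)], where R = "poly_ring V"]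
    show ?case unfolding ideal_power_Suc by (simp add: prod_pvar_eq_monomial finite_A[OF i(1)] mult_single m)
  qed
  then show "monomial_span V (packs r) \<subseteq> ideal_power (poly_ring V) ?I r"
    by (rule monomial_span_subset_ideal[OF ideal_ideal_power[OF poly_ring_ring ideal_generated_ideal]])
qed

text \<open>
  By minimality every \<open>v \<in> C\<close> has a private generator, one that is divisible by no other variable of \<open>C\<close>.
  A prime ideal that contains this generator and lies inside the ideal of \<open>C\<close> must contain \<open>v\<close>.
\<close>

lemma minimal_cover_prime:
  assumes C: "C \<subseteq> V" "{1..q} \<subseteq> (\<Union>v\<in>C. divisible_gens v)"
    and minimal: "\<And>D. D \<subset> C \<Longrightarrow> \<not> {1..q} \<subseteq> (\<Union>v\<in>D. divisible_gens v)"
  shows "(monomial_span V (\<lambda>m. \<exists>v\<in>C. 0 < Poly_Mapping.lookup m v) :: (('v \<Rightarrow>\<^sub>0 nat) \<Rightarrow>\<^sub>0 'k::field) set)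
    \<in> minimal_primes (poly_ring V) generated_ideal"
    (is "?P \<in> _")
  unfolding minimal_primes_def
proof (intro CollectI conjI allI impI)
  show "primeideal ?P (poly_ring V)" by (rule primeideal_monomial_span_variables[OF finite_V C(1)])
  show "generated_ideal \<subseteq> ?P"
    unfolding generated_ideal_eq monomial_span_subset_iff using C by (fastforce simp: divisible_gens_def)
next
  fix Q :: "(('v \<Rightarrow>\<^sub>0 nat) \<Rightarrow>\<^sub>0 'k) set"
  assume "primeideal Q (poly_ring V) \<and> generated_ideal \<subseteq> Q \<and> Q \<subseteq> ?P"
  then have Q: "primeideal Q (poly_ring V)" "generated_ideal \<subseteq> Q" "Q \<subseteq> ?P" by auto
  interpret Q: primeideal Q "poly_ring V" by (rule Q)
  have var: "pvar v \<in> Q" if v: "v \<in> C" for v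
  proof -
    have "C - {v} \<subset> C" using v by blast
    from minimal[OF this] obtain i where i: "i \<in> {1..q}" "i \<notin> (\<Union>v\<in>C - {v}. divisible_gens v)" by blast
    have "(\<Prod>v\<in>A i. pvar v) \<in> Q" using generator_in_generated_ideal[OF i(1)] Q(2) by blast
    from primeideal_contains_variable[OF Q(1) finite_A[OF i(1)] A_subset[OF i(1)] this]
    obtain u where u: "u \<in> A i" "pvar u \<in> Q" by blast
    then have "(pvar u :: ('v \<Rightarrow>\<^sub>0 nat) \<Rightarrow>\<^sub>0 'k) \<in> ?P" using Q(3) by blast
    then have "u \<in> C" by (auto simp: monomial_span_def pvar_def lookup_single when_def split: if_splits)
    then show ?thesis using u i(2) by (cases "u = v") (auto simp: divisible_gens_def)
  qed
  have "?P \<subseteq> Q"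
  proof (rule monomial_span_subset_ideal[OF Q.is_ideal])
    fix m assume m: "exponents_in V m" "\<exists>v\<in>C. 0 < Poly_Mapping.lookup m v"
    then obtain v where v: "v \<in> C" "0 < Poly_Mapping.lookup m v" by blast
    have eq: "m = Poly_Mapping.single v 1 + (m - Poly_Mapping.single v 1)"
      using v(2) by (intro poly_mapping_eqI) (auto simp: lookup_add lookup_minus lookup_single when_def)
    have "exponents_in V (m - Poly_Mapping.single v 1)"
      using m(1) by (auto simp: in_keys_iff lookup_minus subset_iff)
    then show "monomial m \<in> Q"
      using var[OF v(1)] unfolding pvar_def
      by (subst eq) (rule monomial_mult_in_ideal[OF Q.is_ideal])
  qed
  then show "Q = ?P" using Q(3) by blast
qed

lemma minimal_cover_exists:
  assumes "C \<subseteq> V" "{1..q} \<subseteq> (\<Union>v\<in>C. divisible_gens v)"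
  shows "\<exists>C'\<subseteq>C. {1..q} \<subseteq> (\<Union>v\<in>C'. divisible_gens v) \<and> (\<forall>D. D \<subset> C' \<longrightarrow> \<not> {1..q} \<subseteq> (\<Union>v\<in>D. divisible_gens v))"
  using assms
proof (induction "card C" arbitrary: C rule: less_induct)
  case less
  show ?case
  proof (cases "\<exists>D. D \<subset> C \<and> {1..q} \<subseteq> (\<Union>v\<in>D. divisible_gens v)")
    case True
    then obtain D where D: "D \<subset> C" "{1..q} \<subseteq> (\<Union>v\<in>D. divisible_gens v)" by blast
    have "finite C" using less.prems finite_V finite_subset by blast
    then have "card D < card C" using D by (intro psubset_card_mono)
    moreover have "D \<subseteq> V" using D less.prems by blast
    ultimately obtain C' where "C' \<subseteq> D" "{1..q} \<subseteq> (\<Union>v\<in>C'. divisible_gens v) \<and> (\<forall>D. D \<subset> C' \<longrightarrow> \<not> {1..q} \<subseteq> (\<Union>v\<in>D. divisible_gens v))"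
      using less.hyps[of D] D(2) by blast
    then show ?thesis using D(1) by blast
  qed (use less.prems in blast)
qed

text \<open>
  One inclusion uses the primes of the minimal covers. For the other one, the variables in any minimal
  prime form a cover, and sufficiently many of them divide \<open>m\<close>.
\<close>

lemma symbolic_power_eq:
  "symbolic_power (poly_ring V) generated_ideal s = (monomial_span V (covers_ge s) :: (('v \<Rightarrow>\<^sub>0 nat) \<Rightarrow>\<^sub>0 'k::field) set)"
proof
  let ?I = "generated_ideal :: (('v \<Rightarrow>\<^sub>0 nat) \<Rightarrow>\<^sub>0 'k) set"
  show "symbolic_power (poly_ring V) generated_ideal s \<subseteq> (monomial_span V (covers_ge s) :: (('v \<Rightarrow>\<^sub>0 nat) \<Rightarrow>\<^sub>0 'k) set)"
  proof
    fix p :: "('v \<Rightarrow>\<^sub>0 nat) \<Rightarrow>\<^sub>0 'k" assume p: "p \<in> symbolic_power (poly_ring V) generated_ideal s"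
    have "covers_ge s m" if m: "m \<in> Poly_Mapping.keys p" for m
      unfolding covers_ge_def
    proof (intro allI impI)
      fix C assume C: "C \<subseteq> V" "{1..q} \<subseteq> (\<Union>v\<in>C. divisible_gens v)"
      then obtain C' where C': "C' \<subseteq> C" "{1..q} \<subseteq> (\<Union>v\<in>C'. divisible_gens v)"
        "\<forall>D. D \<subset> C' \<longrightarrow> \<not> {1..q} \<subseteq> (\<Union>v\<in>D. divisible_gens v)" using minimal_cover_exists[OF C] by (elim exE conjE)
      have fin: "finite C" using C finite_V finite_subset by blast
      have "C' \<subseteq> V" using C' C by blast
      then have "monomial_span V (\<lambda>m. \<exists>v\<in>C'. 0 < Poly_Mapping.lookup m v) \<in> minimal_primes (poly_ring V) ?I"
        using C'(2,3) by (intro minimal_cover_prime) auto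
      then have "p \<in> ideal_power (poly_ring V) (monomial_span V (\<lambda>m. \<exists>v\<in>C'. 0 < Poly_Mapping.lookup m v)) s"
        using p unfolding in_symbolic_power_iff by (elim conjE bspec)
      also have "\<dots> \<subseteq> monomial_span V (\<lambda>m. s \<le> (\<Sum>v\<in>C'. Poly_Mapping.lookup m v))"
      proof (rule ideal_power_monomial_span_subset)
        fix n and a b :: "'v \<Rightarrow>\<^sub>0 nat" assume n: "n \<le> (\<Sum>v\<in>C'. Poly_Mapping.lookup a v)" and "\<exists>v\<in>C'. 0 < Poly_Mapping.lookup b v"
        then obtain v where v: "v \<in> C'" "0 < Poly_Mapping.lookup b v" by blast
        have "Poly_Mapping.lookup b v \<le> (\<Sum>v\<in>C'. Poly_Mapping.lookup b v)"
          using v(1) fin C'(1) by (intro member_le_sum) (auto intro: finite_subset)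
        then show "Suc n \<le> (\<Sum>v\<in>C'. Poly_Mapping.lookup (a + b) v)"
          using n v(2) by (simp add: lookup_add sum.distrib)
      qed simp
      finally have "s \<le> (\<Sum>v\<in>C'. Poly_Mapping.lookup m v)" using m by (auto simp: monomial_span_def)
      also have "\<dots> \<le> (\<Sum>v\<in>C. Poly_Mapping.lookup m v)" using C'(1) fin by (intro sum_mono2) auto
      finally show "s \<le> (\<Sum>v\<in>C. Poly_Mapping.lookup m v)" .
    qed
    moreover have "p \<in> carrier (poly_ring V)" using p unfolding in_symbolic_power_iff by blast
    ultimately show "p \<in> monomial_span V (covers_ge s)" by (auto simp: monomial_span_def)
  qed
  have "(monomial_span V (covers_ge s) :: (('v \<Rightarrow>\<^sub>0 nat) \<Rightarrow>\<^sub>0 'k) set) \<subseteq> ideal_power (poly_ring V) P s"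
    if P: "P \<in> minimal_primes (poly_ring V) generated_ideal" for P
  proof -
    have prime: "primeideal P (poly_ring V)" and sub: "generated_ideal \<subseteq> P"
      using P by (auto simp: minimal_primes_def)
    interpret P: primeideal P "poly_ring V" by (rule prime)
    define C where "C = {v \<in> V. pvar v \<in> P}"
    have "i \<in> (\<Union>v\<in>C. divisible_gens v)" if i: "i \<in> {1..q}" for i
    proof -
      have "(\<Prod>v\<in>A i. pvar v) \<in> P" using generator_in_generated_ideal[OF i] sub by blast
      from primeideal_contains_variable[OF prime finite_A[OF i] A_subset[OF i] this]
      show ?thesis using A_subset[OF i] by (auto simp: C_def divisible_gens_def)
    qed
    then have cover: "{1..q} \<subseteq> (\<Union>v\<in>C. divisible_gens v)" by blast
    have C: "finite C" "C \<subseteq> V" using finite_V by (auto simp: C_def)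
    show ?thesis
    proof (rule monomial_span_subset_ideal[OF ideal_ideal_power[OF poly_ring_ring P.is_ideal]])
      fix m assume m: "exponents_in V m" "covers_ge s m"
      then have "s \<le> (\<Sum>v\<in>C. Poly_Mapping.lookup m v)" using cover C by (auto simp: covers_ge_def)
      then show "monomial m \<in> ideal_power (poly_ring V) P s"
        using m by (intro monomial_in_ideal_power[OF P.is_ideal C(1)]) (auto simp: C_def)
    qed
  qed
  moreover have "(monomial_span V (covers_ge s) :: (('v \<Rightarrow>\<^sub>0 nat) \<Rightarrow>\<^sub>0 'k) set) \<subseteq> carrier (poly_ring V)"
    by (auto simp: monomial_span_def)
  ultimately show "(monomial_span V (covers_ge s) :: (('v \<Rightarrow>\<^sub>0 nat) \<Rightarrow>\<^sub>0 'k) set) \<subseteq> symbolic_power (poly_ring V) generated_ideal s"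
    unfolding symbolic_power_def by blast
qed

lemma symbolic_power_subset_ideal_power_iff:
  "symbolic_power (poly_ring V) (generated_ideal :: (('v \<Rightarrow>\<^sub>0 nat) \<Rightarrow>\<^sub>0 'k::field) set) s
      \<subseteq> ideal_power (poly_ring V) generated_ideal r \<longleftrightarrow>
   (\<forall>m. exponents_in V m \<longrightarrow> covers_ge s m \<longrightarrow> packs r m)"
  unfolding symbolic_power_eq ideal_power_eq by (rule monomial_span_subset_iff)

section \<open>Bounds for the resurgence\<close>

text \<open>
  If \<open>s / r > \<rho>\<close>, then \<open>s t / \<rho> - r t\<close> grows linearly in \<open>t\<close> and exceeds the rounding loss \<open>q\<close> for large \<open>t\<close>.
\<close>

lemma asymptotic_resurgence_le:
  assumes gap: "cover_gap TYPE(nat) TYPE('v) q \<rho>" and \<rho>: "0 < \<rho>"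
  shows "asymptotic_resurgence (poly_ring V) (generated_ideal :: (('v \<Rightarrow>\<^sub>0 nat) \<Rightarrow>\<^sub>0 'k::field) set) \<le> ereal \<rho>"
  unfolding asymptotic_resurgence_def symbolic_power_subset_ideal_power_iff
proof (rule Sup_least, clarify)
  fix s r :: nat assume sr: "0 < s" "0 < r"
    and ev: "\<forall>\<^sub>F t in sequentially. \<not> (\<forall>m. exponents_in V m \<longrightarrow> covers_ge (s * t) m \<longrightarrow> packs (r * t) m)"
  show "ereal (real s / real r) \<le> ereal \<rho>"
  proof (rule ccontr)
    assume "\<not> ?thesis"
    then have "real r < real s / \<rho>" using sr \<rho> by (simp add: field_simps)
    then have \<delta>: "0 < real s / \<rho> - real r" by simp
    obtain t0 where t0: "\<And>t. t \<ge> t0 \<Longrightarrow> \<not> (\<forall>m. exponents_in V m \<longrightarrow> covers_ge (s * t) m \<longrightarrow> packs (r * t) m)"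
      using ev unfolding eventually_sequentially by blast
    obtain t1 :: nat where t1: "real q / (real s / \<rho> - real r) \<le> t1" using real_arch_simple by blast
    define t where "t = max t0 t1"
    have "packs (r * t) m" if m: "covers_ge (s * t) m" for m
    proof -
      have "\<exists>n :: nat \<Rightarrow> nat. real (s * t) / \<rho> - card {1..q} \<le> real (sum n {1..q})
          \<and> (\<forall>v\<in>V. sum n ({1..q} \<inter> divisible_gens v) \<le> Poly_Mapping.lookup m v)"
        by (rule integral_packing_if_covers_expensive) (use gap \<rho> finite_V m in \<open>auto simp: covers_ge_def\<close>)
      then obtain n :: "nat \<Rightarrow> nat" where n: "real (s * t) / \<rho> - card {1..q} \<le> real (sum n {1..q})"
        "\<forall>v\<in>V. sum n ({1..q} \<inter> divisible_gens v) \<le> Poly_Mapping.lookup m v" by blast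
      have "real q / (real s / \<rho> - real r) \<le> real t" using t1 by (simp add: t_def)
      then have "real q \<le> real t * (real s / \<rho> - real r)" using \<delta> by (simp add: pos_divide_le_eq)
      then have "real (r * t) \<le> real (s * t) / \<rho> - real q" by (simp add: algebra_simps)
      then have "real (r * t) \<le> real (sum n {1..q})" using n(1) by simp
      then show ?thesis using n(2) unfolding packs_def of_nat_le_iff by blast
    qed
    then show False using t0[of t] by (auto simp: t_def)
  qed
qed

text \<open>
  A non-containment for \<open>(s t, r t)\<close> has the same quotient as \<open>(s, r)\<close>.
\<close>

lemma asymptotic_resurgence_le_resurgence:
  "asymptotic_resurgence (poly_ring V) (generated_ideal :: (('v \<Rightarrow>\<^sub>0 nat) \<Rightarrow>\<^sub>0 'k::field) set)
    \<le> resurgence (poly_ring V) (generated_ideal :: (('v \<Rightarrow>\<^sub>0 nat) \<Rightarrow>\<^sub>0 'k) set)"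
  unfolding asymptotic_resurgence_def
proof (rule Sup_least, clarify)
  let ?I = "generated_ideal :: (('v \<Rightarrow>\<^sub>0 nat) \<Rightarrow>\<^sub>0 'k) set"
  fix s r :: nat assume sr: "0 < s" "0 < r"
    and "\<forall>\<^sub>F t in sequentially. \<not> symbolic_power (poly_ring V) ?I (s * t) \<subseteq> ideal_power (poly_ring V) ?I (r * t)"
  then obtain t0 where t0: "\<And>t. t \<ge> t0 \<Longrightarrow> \<not> symbolic_power (poly_ring V) ?I (s * t) \<subseteq> ideal_power (poly_ring V) ?I (r * t)"
    unfolding eventually_sequentially by blast
  have "ereal (real s / real r) = ereal (real (s * Suc t0) / real (r * Suc t0))" by (simp del: of_nat_Suc mult_Suc_right)
  also have "\<dots> \<le> resurgence (poly_ring V) ?I"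
    unfolding resurgence_def using sr t0[of "Suc t0"]
    by (intro Sup_upper CollectI exI[of _ "s * Suc t0"] exI[of _ "r * Suc t0"]) auto
  finally show "ereal (real s / real r) \<le> resurgence (poly_ring V) ?I" .
qed

text \<open>
  If the \<open>t\<close>-fold multiple of \<open>m\<close> has a packing of size \<open>r t\<close>, then \<open>m\<close> has a real and hence an integral
  packing of size \<open>r\<close>. So every witness of non-containment persists under multiples.
\<close>

lemma resurgence_eq_if_three_generators:
  assumes "q = 3"
  shows "resurgence (poly_ring V) (generated_ideal :: (('v \<Rightarrow>\<^sub>0 nat) \<Rightarrow>\<^sub>0 'k::field) set)
    = asymptotic_resurgence (poly_ring V) (generated_ideal :: (('v \<Rightarrow>\<^sub>0 nat) \<Rightarrow>\<^sub>0 'k) set)"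
proof (rule antisym[OF _ asymptotic_resurgence_le_resurgence])
  let ?I = "generated_ideal :: (('v \<Rightarrow>\<^sub>0 nat) \<Rightarrow>\<^sub>0 'k) set"
  show "resurgence (poly_ring V) ?I \<le> asymptotic_resurgence (poly_ring V) ?I"
    unfolding resurgence_def symbolic_power_subset_ideal_power_iff
  proof (rule Sup_least, elim CollectE exE conjE)
    fix x and s r :: nat assume x: "x = ereal (real s / real r)" and sr: "0 < s" "0 < r"
      and "\<not> (\<forall>m. exponents_in V m \<longrightarrow> covers_ge s m \<longrightarrow> packs r m)"
    then obtain m where m: "exponents_in V m" "covers_ge s m" "\<not> packs r m" by blast
    have "\<not> (\<forall>m. exponents_in V m \<longrightarrow> covers_ge (s * t) m \<longrightarrow> packs (r * t) m)" if t: "t \<ge> 1" for t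
    proof -
      define mt where "mt = (\<Sum>i<t. m)"
      have look: "Poly_Mapping.lookup mt v = Poly_Mapping.lookup m v * t" for v
        by (simp add: mt_def lookup_sum)
      have "exponents_in V mt" using m(1) by (auto simp: in_keys_iff look subset_iff)
      moreover have "covers_ge (s * t) mt"
        using m(2) unfolding covers_ge_def by (auto simp: look simp flip: sum_distrib_right)
      moreover have "\<not> packs (r * t) mt"
      proof
        assume "packs (r * t) mt"
        then obtain N where N: "r * t \<le> sum N {1..q}"
          "\<And>v. v \<in> V \<Longrightarrow> sum N ({1..q} \<inter> divisible_gens v) \<le> Poly_Mapping.lookup m v * t"
          unfolding packs_def look by blast
        have "packs r m" unfolding packs_def
          by (rule integral_packing_of_three[OF _ _ N]) (use assms t in auto)
        then show False using m(3) by blast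
      qed
      ultimately show ?thesis by blast
    qed
    then have "\<forall>\<^sub>F t in sequentially. \<not> (\<forall>m. exponents_in V m \<longrightarrow> covers_ge (s * t) m \<longrightarrow> packs (r * t) m)"
      unfolding eventually_sequentially by blast
    then show "x \<le> asymptotic_resurgence (poly_ring V) ?I"
      unfolding asymptotic_resurgence_def symbolic_power_subset_ideal_power_iff
      using sr x by (intro Sup_upper CollectI exI[of _ s] exI[of _ r] conjI)
  qed
qed

end

section \<open>The extremal ideals\<close>

lemma squarefree_generators_extremal:
  "squarefree_generators (extremal_vars q) (\<lambda>i. {A \<in> extremal_vars q. i \<in> A}) q"
proof
  show "finite (extremal_vars q)" by (simp add: extremal_vars_def)
  show "{A \<in> extremal_vars q. i \<in> A} \<subseteq> extremal_vars q" for i by blast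
  show "{A \<in> extremal_vars q. i \<in> A} \<noteq> {}" if "i \<in> {1..q}" for i
    using that by (auto simp: extremal_vars_def intro: exI[of _ "{i}"])
qed

lemma extremal_ideal_eq:
  "extremal_ideal q = squarefree_generators.generated_ideal (extremal_vars q) (\<lambda>i. {A \<in> extremal_vars q. i \<in> A}) q"
  unfolding squarefree_generators.generated_ideal_def[OF squarefree_generators_extremal]
  by (simp add: extremal_ideal_def extremal_ring_def extremal_gen_def)

text \<open>
  The witnesses are multiples of the monomial in which proper subsets have exponent \<open>k\<close> and \<open>{1..q}\<close> has
  exponent \<open>2 k\<close>. A cover contains \<open>{1..q}\<close> or at least two other sets. In a packing \<open>n\<close>, the sum over
  every subset of size \<open>q - 1\<close> is at most \<open>k\<close>, so that averaging bounds the total by \<open>k q / (q - 1)\<close>. With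
  \<open>k = (q - 1) j\<close> this is the integer \<open>q j\<close>, and the quotients \<open>2 (q - 1) j / (q j + 1)\<close> tend to the bound.
\<close>

lemma asymptotic_resurgence_extremal_ge:
  assumes q: "2 \<le> q"
  shows "ereal (2 * (real q - 1) / real q) \<le>
    asymptotic_resurgence (extremal_ring q) (extremal_ideal q :: ((nat set \<Rightarrow>\<^sub>0 nat) \<Rightarrow>\<^sub>0 'k::field) set)"
proof -
  interpret E: squarefree_generators "extremal_vars q" "\<lambda>i. {A \<in> extremal_vars q. i \<in> A}" q
    by (rule squarefree_generators_extremal)
  let ?V = "extremal_vars q"
  let ?\<rho> = "asymptotic_resurgence (extremal_ring q) (extremal_ideal q :: ((nat set \<Rightarrow>\<^sub>0 nat) \<Rightarrow>\<^sub>0 'k) set)"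
  have T: "E.divisible_gens B = B" if "B \<in> ?V" for B using that by (auto simp: E.divisible_gens_def)
  have notsub: "\<not> (\<forall>m. exponents_in ?V m \<longrightarrow> E.covers_ge (2 * ((q - 1) * j) * t) m \<longrightarrow> E.packs ((q * j + 1) * t) m)"
    if t: "t \<ge> 1" for j t
  proof -
    define k where "k = (q - 1) * j * t"
    define m :: "nat set \<Rightarrow>\<^sub>0 nat" where
      "m = (\<Sum>B\<in>?V. Poly_Mapping.single B (if B = {1..q} then 2 * k else k))"
    have look: "Poly_Mapping.lookup m B = (if B = {1..q} then 2 * k else k)" if "B \<in> ?V" for B
      using that E.finite_V by (simp add: m_def lookup_sum lookup_single when_def)
    have "exponents_in ?V m"
    proof
      fix B assume "B \<in> Poly_Mapping.keys m"
      then show "B \<in> ?V" using E.finite_V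
        by (auto simp: m_def in_keys_iff lookup_sum lookup_single when_def split: if_splits)
    qed
    moreover have "E.covers_ge (2 * k) m"
      unfolding E.covers_ge_def
    proof (intro allI impI)
      fix C assume C: "C \<subseteq> ?V" "{1..q} \<subseteq> (\<Union>v\<in>C. E.divisible_gens v)"
      have fin: "finite C" using C E.finite_V finite_subset by blast
      have cover: "\<exists>B\<in>C. i \<in> B" if "i \<in> {1..q}" for i using that C T by blast
      show "2 * k \<le> (\<Sum>v\<in>C. Poly_Mapping.lookup m v)"
      proof (cases "{1..q} \<in> C")
        case True
        then have "Poly_Mapping.lookup m {1..q} \<le> (\<Sum>v\<in>C. Poly_Mapping.lookup m v)"
          using fin by (intro member_le_sum) auto
        then show ?thesis using look[of "{1..q}"] C True by auto
      next
        case False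
        obtain B where B: "B \<in> C" using cover[of 1] q by auto
        then have "B \<subset> {1..q}" using C False by (auto simp: extremal_vars_def)
        then obtain i where "i \<in> {1..q}" "i \<notin> B" by blast
        then obtain B' where B': "B' \<in> C" "B' \<noteq> B" using cover by blast
        have "2 * k = (\<Sum>v\<in>{B, B'}. Poly_Mapping.lookup m v)"
          using B B' C False look[of B] look[of B'] by (auto simp: subset_iff)
        also have "\<dots> \<le> (\<Sum>v\<in>C. Poly_Mapping.lookup m v)" using B B' fin by (intro sum_mono2) auto
        finally show ?thesis .
      qed
    qed
    moreover have "\<not> E.packs ((q * j + 1) * t) m"
    proof
      assume "E.packs ((q * j + 1) * t) m"
      then obtain n where n: "(q * j + 1) * t \<le> sum n {1..q}"
        "\<And>B. B \<in> ?V \<Longrightarrow> sum n ({1..q} \<inter> E.divisible_gens B) \<le> Poly_Mapping.lookup m B" unfolding E.packs_def by blast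
      have le: "sum n {1..q} \<le> k + n i" if i: "i \<in> {1..q}" for i
      proof -
        have "\<exists>l\<in>{1..q}. l \<noteq> i" using q by (intro bexI[of _ "if i = 1 then 2 else 1"]) auto
        then have B: "{1..q} - {i} \<in> ?V" unfolding extremal_vars_def by blast
        have "{1..q} - {i} \<noteq> {1..q}" using i by blast
        then have "sum n ({1..q} \<inter> ({1..q} - {i})) \<le> k" using n(2)[OF B(1)] unfolding T[OF B(1)] look[OF B(1)] by simp
        also have "{1..q} \<inter> ({1..q} - {i}) = {1..q} - {i}" by blast
        finally have "sum n ({1..q} - {i}) \<le> k" .
        moreover have "sum n {1..q} = n i + sum n ({1..q} - {i})" using i by (intro sum.remove) auto
        ultimately show ?thesis by linarith
      qed
      have "q * sum n {1..q} = (\<Sum>i\<in>{1..q}. sum n {1..q})" by simp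
      also have "\<dots> \<le> (\<Sum>i\<in>{1..q}. k + n i)" by (intro sum_mono le)
      also have "\<dots> = q * k + sum n {1..q}" by (simp add: sum.distrib)
      finally have "(q - 1) * sum n {1..q} \<le> q * k" using q by (simp add: diff_mult_distrib)
      also have "q * k = (q - 1) * (q * j * t)" by (simp add: k_def)
      finally have "sum n {1..q} \<le> q * j * t" using q by simp
      then show False using n(1) t by simp
    qed
    moreover have k: "2 * ((q - 1) * j) * t = 2 * k" by (simp add: k_def)
    ultimately show ?thesis unfolding k by blast
  qed
  have bound: "ereal (real (2 * ((q - 1) * Suc j)) / real (q * Suc j + 1)) \<le> ?\<rho>" for j
    unfolding asymptotic_resurgence_def extremal_ideal_eq extremal_ring_def E.symbolic_power_subset_ideal_power_iff
  proof (rule Sup_upper, rule CollectI, rule exI[of _ "2 * ((q - 1) * Suc j)"], rule exI[of _ "q * Suc j + 1"], intro conjI)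
    show "\<forall>\<^sub>F t in sequentially. \<not> (\<forall>m. exponents_in ?V m \<longrightarrow>
        E.covers_ge (2 * ((q - 1) * Suc j) * t) m \<longrightarrow> E.packs ((q * Suc j + 1) * t) m)"
      unfolding eventually_sequentially using notsub by blast
  qed (use q in auto)
  have limit: "(\<lambda>j. ereal (real (2 * ((q - 1) * Suc j)) / real (q * Suc j + 1))) \<longlonglongrightarrow> ereal (2 * (real q - 1) / real q)"
  proof -
    have "(\<lambda>j. 2 * (real q - 1) / (real q + inverse (real (Suc j)))) \<longlonglongrightarrow> 2 * (real q - 1) / (real q + 0)"
      by (intro tendsto_intros LIMSEQ_inverse_real_of_nat) (use q in auto)
    moreover have "2 * (real q - 1) / (real q + inverse (real (Suc j))) = real (2 * ((q - 1) * Suc j)) / real (q * Suc j + 1)" for j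
    proof -
      have "real q + inverse (real (Suc j)) = real (q * Suc j + 1) / real (Suc j)" by (simp add: field_simps)
      moreover have "real (2 * ((q - 1) * Suc j)) = 2 * (real q - 1) * real (Suc j)"
        using q by (simp only: of_nat_mult) (simp add: of_nat_diff)
      ultimately show ?thesis by (simp only: divide_divide_eq_right)
    qed
    ultimately show ?thesis by simp
  qed
  show ?thesis by (rule LIMSEQ_le_const2[OF limit]) (use bound in blast)
qed

lemma asymptotic_resurgence_extremal:
  assumes gap: "cover_gap TYPE(nat) TYPE(nat set) q (2 * (real q - 1) / real q)" and q: "2 \<le> q"
  shows "asymptotic_resurgence (extremal_ring q) (extremal_ideal q :: ((nat set \<Rightarrow>\<^sub>0 nat) \<Rightarrow>\<^sub>0 'k::field) set)
    = ereal (2 * (real q - 1) / real q)"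
proof (rule antisym[OF _ asymptotic_resurgence_extremal_ge[OF q]])
  interpret E: squarefree_generators "extremal_vars q" "\<lambda>i. {A \<in> extremal_vars q. i \<in> A}" q
    by (rule squarefree_generators_extremal)
  show "asymptotic_resurgence (extremal_ring q) (extremal_ideal q :: ((nat set \<Rightarrow>\<^sub>0 nat) \<Rightarrow>\<^sub>0 'k::field) set)
    \<le> ereal (2 * (real q - 1) / real q)"
    unfolding extremal_ideal_eq extremal_ring_def using E.asymptotic_resurgence_le[OF gap] q by simp
qed

text \<open>
  A generator 1 would generate the ideal alone, against the irredundance of at least two generators.
\<close>

lemma squarefree_generators_of_min_gens:
  fixes I :: "(('v \<Rightarrow>\<^sub>0 nat) \<Rightarrow>\<^sub>0 'k::field) set"
  assumes V: "finite V" and I: "squarefree_monomial_ideal_with_min_gens V I q" and q: "2 \<le> q"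
  obtains A where "squarefree_generators V A q" "I = squarefree_generators.generated_ideal V A q"
proof -
  obtain G where G: "G \<subseteq> squarefree_monomials V" "finite G" "card G = q" "I = Idl\<^bsub>poly_ring V\<^esub> G"
    and irredundant: "\<And>H. H \<subset> G \<Longrightarrow> Idl\<^bsub>poly_ring V\<^esub> H \<noteq> I"
    using I unfolding squarefree_monomial_ideal_with_min_gens_def by blast
  obtain g where g: "bij_betw g {1..q} G" using ex_bij_betw_nat_finite_1[OF G(2)] G(3) by blast
  have "\<exists>B. finite B \<and> B \<subseteq> V \<and> g i = (\<Prod>v\<in>B. pvar v)" if "i \<in> {1..q}" for i
  proof -
    have "g i \<in> G" using that g by (rule bij_betw_apply[rotated])
    then show ?thesis using G(1) unfolding squarefree_monomials_def by blast
  qed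
  then obtain A where A: "\<And>i. i \<in> {1..q} \<Longrightarrow> finite (A i) \<and> A i \<subseteq> V \<and> g i = (\<Prod>v\<in>A i. pvar v)" by metis
  have gens: "G = (\<lambda>i. \<Prod>v\<in>A i. pvar v) ` {1..q}"
    using g A by (auto simp: bij_betw_def intro!: image_cong)
  have carrier: "G \<subseteq> carrier (poly_ring V)"
    using A by (force simp: gens prod_pvar_eq_monomial monomial_span_def keys_squarefree_exponent)
  have "A i \<noteq> {}" if i: "i \<in> {1..q}" for i
  proof
    assume "A i = {}"
    then have one: "1 \<in> G" unfolding gens using i by (intro image_eqI[of _ _ i]) auto
    have "{1} \<noteq> G" using G(3) q by auto
    with one have "{1} \<subset> G" by blast
    moreover have "Idl\<^bsub>poly_ring V\<^esub> {1} = I"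
    proof -
      interpret ring "poly_ring V :: (('v \<Rightarrow>\<^sub>0 nat) \<Rightarrow>\<^sub>0 'k) ring" by (rule poly_ring_ring)
      have "ideal I (poly_ring V)" unfolding G(4) by (rule genideal_ideal[OF carrier])
      moreover have "1 \<in> I" using genideal_self[OF carrier] one unfolding G(4) by blast
      ultimately have "I = carrier (poly_ring V)" using ideal.one_imp_carrier by fastforce
      then show ?thesis using genideal_one by simp
    qed
    ultimately show False using irredundant by blast
  qed
  then have sg: "squarefree_generators V A q" using V A by unfold_locales auto
  show thesis
    by (rule that[OF sg]) (simp add: squarefree_generators.generated_ideal_def[OF sg] G(4) gens)
qed

theorem proposition4p11:
  fixes V :: "'v set"
    and I :: "(('v \<Rightarrow>\<^sub>0 nat) \<Rightarrow>\<^sub>0 'k::field) set"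
    and q :: nat
  assumes "finite V"
    and "squarefree_monomial_ideal_with_min_gens V I q"
  defines "R \<equiv> (poly_ring V :: (('v \<Rightarrow>\<^sub>0 nat) \<Rightarrow>\<^sub>0 'k) ring)"
    and "S \<equiv> (extremal_ring :: nat \<Rightarrow> ((nat set \<Rightarrow>\<^sub>0 nat) \<Rightarrow>\<^sub>0 'k) ring)"
    and "E \<equiv> (extremal_ideal :: nat \<Rightarrow> ((nat set \<Rightarrow>\<^sub>0 nat) \<Rightarrow>\<^sub>0 'k) set)"
  shows "(q = 3 \<longrightarrow>
            resurgence R I = asymptotic_resurgence R I \<and>
            asymptotic_resurgence R I \<le> resurgence (S 3) (E 3) \<and>
            resurgence (S 3) (E 3) = asymptotic_resurgence (S 3) (E 3) \<and>
            asymptotic_resurgence (S 3) (E 3) = ereal (4 / 3)) \<and>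
         (q = 4 \<longrightarrow>
            asymptotic_resurgence R I \<le> asymptotic_resurgence (S 4) (E 4) \<and>
            asymptotic_resurgence (S 4) (E 4) = ereal (3 / 2)) \<and>
         (q = 5 \<longrightarrow>
            asymptotic_resurgence R I \<le> asymptotic_resurgence (S 5) (E 5) \<and>
            asymptotic_resurgence (S 5) (E 5) = ereal (8 / 5))"
proof -
  have le: "asymptotic_resurgence R I \<le> ereal \<rho>"
    if q: "2 \<le> q" and \<rho>: "0 < \<rho>" "cover_gap TYPE(nat) TYPE('v) q \<rho>" for \<rho>
  proof -
    obtain A where A: "squarefree_generators V A q" "I = squarefree_generators.generated_ideal V A q"
      using squarefree_generators_of_min_gens[OF assms(1,2) q] .
    show ?thesis unfolding R_def A(2)
      by (rule squarefree_generators.asymptotic_resurgence_le[OF A(1) \<rho>(2,1)])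
  qed
  have E3: "asymptotic_resurgence (S 3) (E 3) = ereal (4 / 3)"
    using asymptotic_resurgence_extremal[of 3] cover_gap_3 by (simp add: S_def E_def)
  have E4: "asymptotic_resurgence (S 4) (E 4) = ereal (3 / 2)"
    using asymptotic_resurgence_extremal[of 4] cover_gap_4 by (simp add: S_def E_def)
  have E5: "asymptotic_resurgence (S 5) (E 5) = ereal (8 / 5)"
    using asymptotic_resurgence_extremal[of 5] cover_gap_5 by (simp add: S_def E_def)
  have res_E3: "resurgence (S 3) (E 3) = asymptotic_resurgence (S 3) (E 3)"
    unfolding S_def E_def extremal_ideal_eq extremal_ring_def
    by (rule squarefree_generators.resurgence_eq_if_three_generators[OF squarefree_generators_extremal refl])
  have res_I: "resurgence R I = asymptotic_resurgence R I" if "q = 3"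
  proof -
    have q: "2 \<le> q" using that by simp
    obtain A where A: "squarefree_generators V A q" "I = squarefree_generators.generated_ideal V A q"
      using squarefree_generators_of_min_gens[OF assms(1,2) q] .
    show ?thesis unfolding R_def A(2)
      by (rule squarefree_generators.resurgence_eq_if_three_generators[OF A(1) that])
  qed
  show ?thesis
    using le[of "4/3"] le[of "3/2"] le[of "8/5"] cover_gap_3 cover_gap_4 cover_gap_5 E3 E4 E5 res_E3 res_I
    by auto
qed

end
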